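(* Let $q$ be a prime power, let $0\le m_0\le n$ be integers with $n\ge 1$, and let $M_{m_0}$ be an arbitrary $m_0\times m_0$ matrix over $\mathbf{F}_q$ which is symmetric (respectively alternating, with $q$ odd). Let $M_n(M_{m_0})$ be the random $n\times n$ matrix having $M_{m_0}$ as its upper left corner, whose remaining entries on and above the diagonal (respectively above the diagonal, with zero diagonal) are independent and uniform over $\mathbf{F}_q$, and whose entries below the diagonal are chosen to make the matrix symmetric (respectively alternating). Then $$\|Q(M_n(M_{m_0}))-Q_\bullet\|_{TV}\le\frac{3^{n/2}}{q^{n/2-m_0}},$$ where $Q_\bullet$ is $Q_{sym,\infty}$ in the symmetric case, $Q_{alt,e}$ in the alternating case with $n$ even, and $Q_{alt,o}$ in the alternating case with $n$ odd.
   Context: For an $n\times n$ matrix $M$, $Q(M)=n-\operatorname{rank}(M)$. A matrix $A$ is alternating if $A^T=-A$ (with zero diagonal). The limiting random variables on $\{0,1,2,\dots\}$ are given by $$\mathbf{P}(Q_{sym,\infty}=k)=\frac{\prod_{i=0}^\infty(1-q^{-2i-1})}{\prod_{i=1}^k(q^i-1)},$$ $$\mathbf{P}(Q_{alt,e}=k)=\prod_{i=0}^\infty(1-q^{-2i-1})\frac{q^k}{\prod_{i=1}^k(q^i-1)}\ \text{ for $k$ even, and $0$ for $k$ odd},$$ $$\mathbf{P}(Q_{alt,o}=k)=\prod_{i=0}^\infty(1-q^{-2i-1})\frac{q^k}{\prod_{i=1}^k(q^i-1)}\ \text{ for $k$ odd, and $0$ for $k$ even}.$$ $\|\cdot-\cdot\|_{TV}$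 is the total variation distance between distributions. *)

theory Defs
  imports "HOL-Probability.Probability" "Jordan_Normal_Form.DL_Rank"
begin

definition symmetric :: "'a mat \<Rightarrow> bool" where
  "symmetric A \<longleftrightarrow> transpose_mat A = A"

(* The zero diagonal is a separate requirement because of characteristic 2. *)
definition alternating :: "'a::field mat \<Rightarrow> bool" where
  "alternating A \<longleftrightarrow> transpose_mat A = - A \<and> (\<forall>i<dim_row A. A $$ (i, i) = 0)"

definition corank :: "'a::field mat \<Rightarrow> nat" where
  "corank A = dim_row A - vec_space.rank (dim_row A) A"

definition random_symmetric_extension ::
  "nat \<Rightarrow> nat \<Rightarrow> 'a::{field,finite} mat \<Rightarrow> 'a mat pmf" where
  "random_symmetric_extension n m M =
     map_pmf (\<lambda>u. Matrix.mat n n (\<lambda>(i, j).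
                 if i < m \<and> j < m then M $$ (i, j)
                 else if i \<le> j then u (i, j) else u (j, i)))
       (Pi_pmf {(i, j). i \<le> j \<and> j < n \<and> \<not> (i < m \<and> j < m)} 0 (\<lambda>_. pmf_of_set UNIV))"

definition random_alternating_extension ::
  "nat \<Rightarrow> nat \<Rightarrow> 'a::{field,finite} mat \<Rightarrow> 'a mat pmf" where
  "random_alternating_extension n m M =
     map_pmf (\<lambda>u. Matrix.mat n n (\<lambda>(i, j).
                 if i < m \<and> j < m then M $$ (i, j)
                 else if i < j then u (i, j) else if i = j then 0 else - u (j, i)))
       (Pi_pmf {(i, j). i < j \<and> j < n \<and> \<not> (i < m \<and> j < m)} 0 (\<lambda>_. pmf_of_set UNIV))"

definition tv_dist :: "'a pmf \<Rightarrow> 'a pmf \<Rightarrow> real" where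
  "tv_dist p p' = (SUP A. \<bar>measure_pmf.prob p A - measure_pmf.prob p' A\<bar>)"

definition limit_const :: "nat \<Rightarrow> real" where
  "limit_const q = (\<Prod>i. 1 - 1 / real q ^ (2 * i + 1))"

definition sym_mass :: "nat \<Rightarrow> nat \<Rightarrow> real" where
  "sym_mass q k = limit_const q / (\<Prod>i=1..k. real q ^ i - 1)"

definition alt_even_mass :: "nat \<Rightarrow> nat \<Rightarrow> real" where
  "alt_even_mass q k =
     (if even k then limit_const q * (real q ^ k / (\<Prod>i=1..k. real q ^ i - 1)) else 0)"

definition alt_odd_mass :: "nat \<Rightarrow> nat \<Rightarrow> real" where
  "alt_odd_mass q k =
     (if odd k then limit_const q * (real q ^ k / (\<Prod>i=1..k. real q ^ i - 1)) else 0)"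

(* embed_pmf is only meaningful if the masses are nonnegative and add up to 1;
   see pmf_Q_sym_infty, pmf_Q_alt_e and pmf_Q_alt_o below. *)
definition Q_sym_infty :: "nat \<Rightarrow> nat pmf" where
  "Q_sym_infty q = embed_pmf (sym_mass q)"

definition Q_alt_e :: "nat \<Rightarrow> nat pmf" where
  "Q_alt_e q = embed_pmf (alt_even_mass q)"

definition Q_alt_o :: "nat \<Rightarrow> nat pmf" where
  "Q_alt_o q = embed_pmf (alt_odd_mass q)"

context
  fixes q :: nat
  assumes q: "q \<ge> 2"
begin

private definition b :: "nat \<Rightarrow> real" where
  "b k = real q ^ k / (\<Prod>i=1..k. real q ^ i - 1)"

private definition F :: "real \<Rightarrow> real" where
  "F z = (\<Sum>k. b k * z ^ k)"

private abbreviation x :: real where "x \<equiv> 1 / real q"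

private lemma x: "0 < x" "x < 1" "x \<le> 1 / 2"
  using q by (auto simp: field_simps)

private lemma xpow_lt1: "x ^ Suc k < 1"
  by (rule power_Suc_less_one[OF x(1,2)])

private lemma qpow_gt1: "real q ^ Suc k - 1 > 0"
  using q one_less_power[of "real q" "Suc k"] by simp

private lemma den_pos: "(\<Prod>i=1..k. real q ^ i - 1) > 0"
proof (rule prod_pos)
  fix i assume "i \<in> {1..k}"
  then obtain j where "i = Suc j" by (cases i) auto
  then show "0 < real q ^ i - 1" using qpow_gt1 by simp
qed

private lemma b_pos: "b k > 0"
  unfolding b_def using q den_pos by simp

private lemma b_0: "b 0 = 1"
  by (simp add: b_def)

private lemma b_Suc: "b (Suc k) = b k * real q / (real q ^ Suc k - 1)"
  by (simp add: b_def)

private lemma b_rec: "b (Suc k) = b (Suc k) * x ^ Suc k + b k * x ^ k"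
proof -
  define Q where "Q = real q ^ k"
  have "Q > 0" using q by (simp add: Q_def)
  moreover have "real q * Q - 1 > 0" using qpow_gt1[of k] by (simp add: Q_def)
  moreover have "real q > 0" using q by simp
  ultimately show ?thesis
    by (simp add: b_Suc power_divide Q_def[symmetric] divide_simps) (simp add: algebra_simps)
qed

private lemma F_summable: "summable (\<lambda>k. b k * z ^ k)"
proof -
  have lim: "(\<lambda>k. real q * \<bar>z\<bar> / (real q ^ Suc k - 1)) \<longlonglongrightarrow> 0"
  proof (rule real_tendsto_divide_at_top[OF tendsto_const])
    have "filterlim (\<lambda>k. real q ^ k) at_top sequentially"
      using q by (intro filterlim_at_infinity_imp_filterlim_at_top
            filterlim_realpow_sequentially_gt1 always_eventually) auto
    then have "filterlim (\<lambda>k. real q ^ Suc k) at_top sequentially"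
      by (subst filterlim_sequentially_Suc)
    then show "filterlim (\<lambda>k. real q ^ Suc k - 1) at_top sequentially"
      using filterlim_tendsto_add_at_top[OF tendsto_const[of "-1"], of "\<lambda>k. real q ^ Suc k"]
      by simp
  qed
  from order_tendstoD(2)[OF lim, of "1/2"] obtain N where
    N: "\<And>k. k \<ge> N \<Longrightarrow> real q * \<bar>z\<bar> / (real q ^ Suc k - 1) < 1 / 2"
    by (auto simp: eventually_sequentially)
  show ?thesis
  proof (rule summable_ratio_test[of "1/2" N])
    fix k assume "N \<le> k"
    have "norm (b (Suc k) * z ^ Suc k)
            = (real q * \<bar>z\<bar> / (real q ^ Suc k - 1)) * norm (b k * z ^ k)"
      using qpow_gt1[of k] b_pos[of k]
      by (simp add: b_Suc abs_mult power_abs del: power_Suc)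
    also have "\<dots> \<le> 1 / 2 * norm (b k * z ^ k)"
      using N[OF \<open>N \<le> k\<close>] by (intro mult_right_mono) auto
    finally show "norm (b (Suc k) * z ^ Suc k) \<le> 1 / 2 * norm (b k * z ^ k)" .
  qed simp
qed

private lemma F_rec: "F z = (1 + z) * F (z * x)"
proof -
  let ?s = "\<lambda>k. b k * (z * x) ^ k"
  have s: "summable ?s" by (rule F_summable)
  have "F z = b 0 + (\<Sum>k. b (Suc k) * z ^ Suc k)"
    unfolding F_def using suminf_split_head[OF F_summable[of z]] by simp
  also have "(\<lambda>k. b (Suc k) * z ^ Suc k) = (\<lambda>k. ?s (Suc k) + z * ?s k)"
  proof
    fix k
    have "b (Suc k) * z ^ Suc k = (b (Suc k) * x ^ Suc k + b k * x ^ k) * z ^ Suc k"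
      using b_rec by metis
    then show "b (Suc k) * z ^ Suc k = ?s (Suc k) + z * ?s k"
      by (simp only: power_mult_distrib) (simp add: algebra_simps)
  qed
  also have "(\<Sum>k. ?s (Suc k) + z * ?s k) = (\<Sum>k. ?s (Suc k)) + z * (\<Sum>k. ?s k)"
    using s summable_Suc_iff[of ?s]
    by (subst suminf_add[symmetric])
       (auto intro!: summable_mult simp: suminf_mult simp del: power_Suc)
  also have "(\<Sum>k. ?s (Suc k)) = (\<Sum>k. ?s k) - b 0"
    using suminf_split_head[OF s] by simp
  finally show ?thesis
    by (simp add: F_def algebra_simps)
qed

private lemma F_prod: "F x = (\<Prod>i<N. 1 + x ^ Suc i) * F (x ^ Suc N)"
proof (induction N)
  case (Suc N)
  have "F (x ^ Suc N) = (1 + x ^ Suc N) * F (x ^ Suc (Suc N))"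
    using F_rec[of "x ^ Suc N"] by (simp add: mult_ac)
  then show ?case using Suc by (simp add: mult_ac)
qed simp

private lemma F_0: "F 0 = 1"
  unfolding F_def using powser_zero[of b] by (simp add: b_0)

private lemma prod_lim: "(\<lambda>N. \<Prod>i<N. 1 + x ^ Suc i) \<longlonglongrightarrow> F x"
proof -
  have "isCont F 0"
    unfolding F_def by (rule isCont_powser[OF F_summable[of 1]]) simp
  moreover have "(\<lambda>N. x ^ Suc N) \<longlonglongrightarrow> 0"
    using x by (subst filterlim_sequentially_Suc, intro LIMSEQ_realpow_zero) auto
  ultimately have "(\<lambda>N. F (x ^ Suc N)) \<longlonglongrightarrow> F 0"
    by (rule isCont_tendsto_compose)
  then have l: "(\<lambda>N. F (x ^ Suc N)) \<longlonglongrightarrow> 1" by (simp only: F_0)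
  have "(\<lambda>N. F x / F (x ^ Suc N)) \<longlonglongrightarrow> F x / 1"
    by (intro tendsto_divide tendsto_const l) simp
  moreover have "\<forall>\<^sub>F N in sequentially. F x / F (x ^ Suc N) = (\<Prod>i<N. 1 + x ^ Suc i)"
    using order_tendstoD(1)[OF l, of 0]
  proof (rule eventually_mono)
    show "F x / F (x ^ Suc N) = (\<Prod>i<N. 1 + x ^ Suc i)" if "0 < F (x ^ Suc N)" for N
      using that F_prod[of N] by (simp del: power_Suc)
  qed simp
  ultimately show ?thesis
    using Lim_transform_eventually by fastforce
qed

private lemma conv:
  assumes "strict_mono f"
  shows "convergent_prod (\<lambda>i. 1 - x ^ Suc (f i))"
proof -
  have pos: "0 < x ^ Suc (f i) \<and> x ^ Suc (f i) < 1" for i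
    using x(1) xpow_lt1 zero_less_power by blast
  have "summable (\<lambda>i. x ^ i)"
    using x by (intro summable_geometric) auto
  then have "summable (\<lambda>i. \<bar>- (x ^ Suc (f i))\<bar>)"
  proof (rule summable_comparison_test'[where N = 0])
    fix i
    have "i \<le> Suc (f i)" using strict_mono_imp_increasing[OF assms, of i] by simp
    then show "norm \<bar>- (x ^ Suc (f i))\<bar> \<le> x ^ i"
      using power_decreasing[of i "Suc (f i)" x] x by (simp del: power_Suc)
  qed
  then have "convergent_prod (\<lambda>i. 1 + - (x ^ Suc (f i)))"
  proof (rule summable_imp_convergent_prod_real)
    show "- (x ^ Suc (f k)) \<noteq> - 1" for k
      using pos[of k] by (metis less_irrefl neg_equal_iff_equal)
  qed
  then show ?thesis by simp
qed

private lemma split_prod: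
  "(\<Prod>i<2 * N. 1 - x ^ Suc i)
     = (\<Prod>i<N. 1 - x ^ Suc (2 * i)) * ((\<Prod>i<N. 1 + x ^ Suc i) * (\<Prod>i<N. 1 - x ^ Suc i))"
proof (induction N)
  case (Suc N)
  have "Suc (2 * N + 1) = Suc N + Suc N" by simp
  then have "x ^ Suc (2 * N + 1) = x ^ Suc N * x ^ Suc N"
    by (simp only: power_add)
  then have *: "1 - x ^ Suc (2 * N + 1) = (1 + x ^ Suc N) * (1 - x ^ Suc N)"
    by (simp only: algebra_simps)
  have "2 * Suc N = Suc (Suc (2 * N))" by simp
  then show ?case using Suc * by (simp add: mult_ac del: power_Suc)
qed simp

private lemma const_eq: "limit_const q = (\<Prod>i. 1 - x ^ Suc (2 * i))"
  by (simp add: limit_const_def power_divide)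

private lemma const_F: "limit_const q * F x = 1"
proof -
  define P where "P = (\<Prod>i. 1 - x ^ Suc i)"
  have cP: "convergent_prod (\<lambda>i. 1 - x ^ Suc i)"
    using conv[of "\<lambda>i. i"] by (simp add: strict_mono_def)
  have P0: "P \<noteq> 0"
    unfolding P_def by (rule prodinf_nonzero[OF cP]) (metis xpow_lt1 less_irrefl right_minus_eq)
  have PN: "(\<lambda>N. \<Prod>i<N. 1 - x ^ Suc i) \<longlonglongrightarrow> P"
    unfolding P_def using has_prod_imp_tendsto' convergent_prod_has_prod[OF cP] by blast
  have P2: "(\<lambda>N. \<Prod>i<2 * N. 1 - x ^ Suc i) \<longlonglongrightarrow> P"
    using LIMSEQ_subseq_LIMSEQ[OF PN, of "\<lambda>N. 2 * N"] by (simp add: strict_mono_def o_def)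
  have "convergent_prod (\<lambda>i. 1 - x ^ Suc (2 * i))"
    by (rule conv) (simp add: strict_mono_def)
  then have "(\<lambda>N. \<Prod>i<N. 1 - x ^ Suc (2 * i)) \<longlonglongrightarrow> limit_const q"
    unfolding const_eq using has_prod_imp_tendsto' convergent_prod_has_prod by blast
  then have "(\<lambda>N. \<Prod>i<2 * N. 1 - x ^ Suc i) \<longlonglongrightarrow> limit_const q * (F x * P)"
    unfolding split_prod by (intro tendsto_mult prod_lim PN)
  then have "limit_const q * (F x * P) = P"
    using LIMSEQ_unique P2 by blast
  then show ?thesis using P0 by simp
qed

private lemma F_x_pos: "F x > 0"
  unfolding F_def using x b_pos by (intro suminf_pos F_summable) simp

private lemma const_pos: "limit_const q > 0"
proof (rule zero_less_mult_pos2)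
  show "0 < limit_const q * F x" unfolding const_F by simp
qed (rule F_x_pos)

private lemma F_sums: "(\<lambda>k. b k * z ^ k) sums F z"
  unfolding F_def by (rule summable_sums[OF F_summable])

private lemma embed:
  fixes f :: "nat \<Rightarrow> real"
  assumes "\<And>k. f k \<ge> 0" "f sums 1"
  shows "pmf (embed_pmf f) k = f k"
proof (rule pmf_embed_pmf)
  show "(\<integral>\<^sup>+ k. ennreal (f k) \<partial>count_space UNIV) = 1"
    unfolding nn_integral_count_space_nat using assms
    by (subst suminf_ennreal2) (auto simp: sums_iff)
qed (rule assms)

lemma pmf_Q_sym_infty: "pmf (Q_sym_infty q) k = sym_mass q k"
  unfolding Q_sym_infty_def
proof (rule embed)
  have eq: "sym_mass q k = limit_const q * (b k * x ^ k)" for k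
    using q by (simp add: sym_mass_def b_def power_divide)
  show "sym_mass q k \<ge> 0" for k
    unfolding eq using const_pos b_pos[of k] x by simp
  show "sym_mass q sums 1"
    using sums_mult[OF F_sums[of x], of "limit_const q"] const_F by (simp add: eq[abs_def])
qed

private lemma half_sums:
  assumes "s = 1 \<or> s = -1"
  shows "(\<lambda>k. limit_const q * (b k * (1 + s * (-1) ^ k) / 2)) sums 1"
proof -
  have "F 1 = 2 * F x" "F (-1) = 0"
    using F_rec[of 1] F_rec[of "-1"] by auto
  then have "(\<lambda>k. limit_const q * ((b k * 1 ^ k + s * (b k * (-1) ^ k)) / 2))
               sums (limit_const q * ((2 * F x + s * 0) / 2))"
    using F_sums[of 1] F_sums[of "-1"]
    by (intro sums_mult sums_divide sums_add) auto
  then show ?thesis using const_F by (simp add: algebra_simps)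
qed

lemma pmf_Q_alt_e: "pmf (Q_alt_e q) k = alt_even_mass q k"
  unfolding Q_alt_e_def
proof (rule embed)
  have eq: "alt_even_mass q k = limit_const q * (b k * (1 + 1 * (-1) ^ k) / 2)" for k
    by (simp add: alt_even_mass_def b_def)
  show "alt_even_mass q k \<ge> 0" for k
    using const_pos den_pos[of k] by (simp add: alt_even_mass_def)
  show "alt_even_mass q sums 1"
    using half_sums[of 1] by (simp only: eq[abs_def]) simp
qed

lemma pmf_Q_alt_o: "pmf (Q_alt_o q) k = alt_odd_mass q k"
  unfolding Q_alt_o_def
proof (rule embed)
  have eq: "alt_odd_mass q k = limit_const q * (b k * (1 + (-1) * (-1) ^ k) / 2)" for k
    by (simp add: alt_odd_mass_def b_def)
  show "alt_odd_mass q k \<ge> 0" for k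
    using const_pos den_pos[of k] by (simp add: alt_odd_mass_def)
  show "alt_odd_mass q sums 1"
    using half_sums[of "-1"] by (simp only: eq[abs_def]) simp
qed

end

end

theory Submission
  imports Defs "Berlekamp_Zassenhaus.Berlekamp_Type_Based"
begin

text \<open>Both families satisfy \<open>A\<^sup>T = \<epsilon> A\<close> for a sign \<open>\<epsilon>\<close>: \<open>\<epsilon> = 1\<close> in the symmetric case, \<open>\<epsilon> = -1\<close> in the
alternating one. The random extension grows by one bordering at a time: a uniform new column
\<open>v\<close> above a new corner \<open>a\<close>, uniform among the elements with \<open>\<epsilon> a = a\<close> (all of the field, or only
\<open>0\<close>). Write \<open>c\<close> for the number of these corners and \<open>k\<close> for the corank of \<open>A\<close>. Since \<open>\<epsilon>\<close>-symmetry
makes the image of \<open>A\<close> the orthogonal complement of its kernel, the new corank depends on \<open>A\<close> only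
through \<open>k\<close>: it is \<open>k - 1\<close> if \<open>v\<close> lies outside the image, which has probability \<open>1 - 1 / q\<^sup>k\<close>; if
\<open>v = A w\<close>, it is \<open>k + 1\<close> for the single corner \<open>a = \<epsilon> (v \<bullet> w)\<close> and \<open>k\<close> for the others
(\<open>corank_border_image\<close>, \<open>corank_border_not_image\<close>, \<open>expectation_random_border\<close>). So the corank
is a Markov chain on the naturals, and the limiting laws are those which it preserves, or in the
alternating case exchanges, because they satisfy detailed balance (\<open>corank_walk_stationary\<close>).

It remains to see that the chain forgets its starting point. Let \<open>d = 1\<close> in the symmetric and
\<open>d = 2\<close> in the alternating case, where the parity of the corank is determined by the size. The
differences \<open>g k = f (k + d) - f k\<close> of a test function are transformed by one step into
\<open>(1 - 1 / q\<^sup>k) g (k - 1) + (1 / q\<^sup>k\<^sup>+\<^sup>2) g (k + 1)\<close>, the same positive operator in both cases. It has the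
eigenfunction \<open>q\<^sup>k\<close> with eigenvalue \<open>1 / q\<close>, so differences bounded by \<open>q\<^sup>k\<close> shrink by the factor
\<open>1 / q\<close> in each step (\<open>corank_walk_contraction\<close>). Take for \<open>f\<close> the indicator of a set, and start one
copy of the chain at the corank of the \<open>m \<times> m\<close> matrix, which is at most \<open>m\<close>, and the other at
stationarity, where the expectation of \<open>q\<close> to the power of the corank is \<open>1 + q / c\<close>. After \<open>t\<close>
steps the total variation distance is at most \<open>q\<^sup>m / q\<^sup>t\<close> (\<open>tv_dist_bordered_chain\<close>), and this,
together with the trivial bound \<open>1\<close>, implies the bound claimed.\<close>

no_notation inner (infix "\<bullet>" 70)
no_notation vec_nth (infixl "$" 90)

section \<open>Counting kernels and images over a finite field\<close>

lemma card_field_ge_2: "CARD('a::{field,finite}) \<ge> 2"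
  using card_mono[of "UNIV :: 'a set" "{0, 1}"] by simp

lemma scalar_prod_add_smult:
  fixes v x y :: "'a::comm_ring_1 vec"
  assumes "v \<in> carrier_vec n" "x \<in> carrier_vec n" "y \<in> carrier_vec n"
  shows "v \<bullet> (x + a \<cdot>\<^sub>v y) = v \<bullet> x + a * (v \<bullet> y)"
  using assms by (simp add: scalar_prod_add_distrib[where n = n])

lemma add_smult_uminus_cancel:
  fixes x y :: "'a::comm_ring_1 vec"
  assumes "x \<in> carrier_vec n" "y \<in> carrier_vec n"
  shows "x + a \<cdot>\<^sub>v y + (- a) \<cdot>\<^sub>v y = x" "x + (- a) \<cdot>\<^sub>v y + a \<cdot>\<^sub>v y = x"
  using assms by (auto intro!: eq_vecI)

text \<open>Adding multiples of \<open>x0\<close> permutes the level sets of the functional \<open>x \<mapsto> v \<bullet> x\<close> on \<open>S\<close>, so its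
\<open>q\<close> level sets have equal size.\<close>

lemma card_functional_kernel:
  fixes S :: "'a::{field,finite} vec set"
  assumes S: "S \<subseteq> carrier_vec n"
    and closed: "\<And>x y a. x \<in> S \<Longrightarrow> y \<in> S \<Longrightarrow> x + a \<cdot>\<^sub>v y \<in> S"
    and v: "v \<in> carrier_vec n" and x0: "x0 \<in> S" "v \<bullet> x0 \<noteq> 0"
  shows "CARD('a) * card {x \<in> S. v \<bullet> x = 0} = card S"
proof -
  have fin: "finite S"
    using S finite_carrier_vec finite_subset by blast
  have lin: "v \<bullet> (x + a \<cdot>\<^sub>v x0) = v \<bullet> x + a * (v \<bullet> x0)" if "x \<in> S" for x a
    using that S v x0 by (intro scalar_prod_add_smult[where n = n]) auto
  have fibre: "card {x \<in> S. v \<bullet> x = a} = card {x \<in> S. v \<bullet> x = 0}" for a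
  proof (rule bij_betw_same_card)
    let ?t = "a / (v \<bullet> x0)"
    show "bij_betw (\<lambda>x. x + (- ?t) \<cdot>\<^sub>v x0) {x \<in> S. v \<bullet> x = a} {x \<in> S. v \<bullet> x = 0}"
    proof (rule bij_betwI[where g = "\<lambda>x. x + ?t \<cdot>\<^sub>v x0"])
      show "(\<lambda>x. x + (- ?t) \<cdot>\<^sub>v x0) \<in> {x \<in> S. v \<bullet> x = a} \<rightarrow> {x \<in> S. v \<bullet> x = 0}"
        using closed x0 lin by auto
      show "(\<lambda>x. x + ?t \<cdot>\<^sub>v x0) \<in> {x \<in> S. v \<bullet> x = 0} \<rightarrow> {x \<in> S. v \<bullet> x = a}"
        using closed x0 lin by auto
    qed (use S x0(1) in \<open>auto intro!: add_smult_uminus_cancel[where n = n]\<close>)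
  qed
  have "S = (\<Union>a. {x \<in> S. v \<bullet> x = a})" by auto
  then have "card S = card (\<Union>a. {x \<in> S. v \<bullet> x = a})" by simp
  also have "\<dots> = (\<Sum>a\<in>UNIV. card {x \<in> S. v \<bullet> x = a})"
    using fin by (intro card_UN_disjoint) auto
  also have "\<dots> = (\<Sum>a\<in>(UNIV :: 'a set). card {x \<in> S. v \<bullet> x = 0})"
    by (intro sum.cong refl fibre)
  finally show ?thesis by simp
qed

text \<open>Double counting of the orthogonal pairs in \<open>S \<times> V\<close>, which replaces a choice of bases. A vector of
the complement is orthogonal to all of \<open>S\<close>, any other one to a \<open>q\<close>-th part of \<open>S\<close>; in the other
direction, \<open>0 \<in> S\<close> is orthogonal to all of \<open>V\<close>, any other element to a \<open>q\<close>-th part of \<open>V\<close>.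
Comparing the two counts leaves the claim times \<open>q - 1\<close>.\<close>

lemma card_orthogonal_complement:
  fixes S :: "'a::{field,finite} vec set"
  assumes S: "S \<subseteq> carrier_vec n" and zero: "0\<^sub>v n \<in> S"
    and closed: "\<And>x y a. x \<in> S \<Longrightarrow> y \<in> S \<Longrightarrow> x + a \<cdot>\<^sub>v y \<in> S"
  shows "card S * card {v \<in> carrier_vec n. \<forall>x\<in>S. v \<bullet> x = 0} = CARD('a) ^ n"
proof -
  let ?V = "carrier_vec n :: 'a vec set" and ?q = "CARD('a)"
  let ?T = "{v \<in> ?V. \<forall>x\<in>S. v \<bullet> x = 0}"
  have fin: "finite S"
    using S finite_carrier_vec finite_subset by blast
  have q2: "?q > 1" and q: "?q \<ge> 1"
    using card_field_ge_2[where 'a = 'a] by simp_all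
  \<comment> \<open>The number of orthogonal pairs, counted first by \<open>v\<close> and then by \<open>x\<close>.\<close>
  define N where "N = (\<Sum>v\<in>?V. card {x \<in> S. v \<bullet> x = 0})"
  have "?q * N = (\<Sum>v\<in>?V. ?q * card {x \<in> S. v \<bullet> x = 0})"
    by (simp add: N_def sum_distrib_left)
  also have "\<dots> = (\<Sum>v\<in>?V. card S + (if v \<in> ?T then (?q - 1) * card S else 0))"
  proof (rule sum.cong[OF refl])
    fix v assume v: "v \<in> ?V"
    show "?q * card {x \<in> S. v \<bullet> x = 0} = card S + (if v \<in> ?T then (?q - 1) * card S else 0)"
    proof (cases "v \<in> ?T")
      case True
      then have "{x \<in> S. v \<bullet> x = 0} = S" by auto
      then show ?thesis using True q by (simp add: diff_mult_distrib)
    next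
      case False
      then obtain x0 where x0: "x0 \<in> S" "v \<bullet> x0 \<noteq> 0" using v by auto
      have "?q * card {x \<in> S. v \<bullet> x = 0} = card S"
        by (intro card_functional_kernel[where n = n and ?x0.0 = x0] S closed v x0)
      moreover have "v \<notin> ?T" using False .
      ultimately show ?thesis by (simp only: if_False)
    qed
  qed
  also have "\<dots> = card ?V * card S + card ?T * ((?q - 1) * card S)"
    by (subst sum.distrib, subst sum.inter_filter[symmetric]) simp_all
  finally have A: "?q * N = card ?V * card S + card ?T * ((?q - 1) * card S)" .
  have "N = (\<Sum>v\<in>?V. \<Sum>x\<in>S. if v \<bullet> x = 0 then 1 else 0)"
    unfolding N_def using fin by (intro sum.cong) (simp_all add: sum.If_cases Int_def)
  also have "\<dots> = (\<Sum>x\<in>S. \<Sum>v\<in>?V. if v \<bullet> x = 0 then 1 else 0)"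
    by (rule sum.swap)
  also have "\<dots> = (\<Sum>x\<in>S. card {v \<in> ?V. v \<bullet> x = 0})"
    by (intro sum.cong) (simp_all add: sum.If_cases Int_def)
  finally have "?q * N = (\<Sum>x\<in>S. ?q * card {v \<in> ?V. v \<bullet> x = 0})"
    by (simp add: sum_distrib_left)
  also have "\<dots> = (\<Sum>x\<in>S. card ?V + (if x = 0\<^sub>v n then (?q - 1) * card ?V else 0))"
  proof (rule sum.cong[OF refl])
    fix x assume "x \<in> S"
    then have x: "x \<in> ?V" using S by auto
    have comm: "{v \<in> ?V. v \<bullet> x = 0} = {v \<in> ?V. x \<bullet> v = 0}"
      using x comm_scalar_prod by (metis (no_types, lifting))
    show "?q * card {v \<in> ?V. v \<bullet> x = 0} = card ?V + (if x = 0\<^sub>v n then (?q - 1) * card ?V else 0)"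
    proof (cases "x = 0\<^sub>v n")
      case True
      then have "{v \<in> ?V. v \<bullet> x = 0} = ?V" by auto
      then show ?thesis using True q by (simp add: diff_mult_distrib)
    next
      case False
      then obtain i where i: "i < n" "x $ i \<noteq> 0"
        using x by (metis eq_vecI carrier_vecD index_zero_vec)
      then have "x \<bullet> unit_vec n i \<noteq> 0"
        using x by (simp add: scalar_prod_right_unit)
      then have "?q * card {v \<in> ?V. x \<bullet> v = 0} = card ?V"
        by (intro card_functional_kernel[where ?x0.0 = "unit_vec n i", OF _ _ x]) auto
      then show ?thesis using False comm by simp
    qed
  qed
  also have "\<dots> = card S * card ?V + (?q - 1) * card ?V"
    using fin zero by (simp add: sum.distrib)
  finally have "(?q - 1) * (card S * card ?T) = (?q - 1) * card ?V"
    using A by (auto simp: mult_ac)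
  then have "card S * card ?T = card ?V" using q2 by auto
  then show ?thesis by (simp only: card_carrier_vec)
qed

lemma mult_mat_vec_add_smult:
  fixes A :: "'a::field mat"
  assumes "A \<in> carrier_mat m n" "x \<in> carrier_vec n" "y \<in> carrier_vec n"
  shows "A *\<^sub>v (x + a \<cdot>\<^sub>v y) = A *\<^sub>v x + a \<cdot>\<^sub>v (A *\<^sub>v y)"
  using assms
  by (simp add: mult_add_distrib_mat_vec[where nr = m and nc = n]
      Matrix.mult_mat_vec[where nr = m and nc = n])

lemma card_kernel_times_image:
  fixes A :: "'a::{field,finite} mat"
  assumes A: "A \<in> carrier_mat m n"
  shows "card (mat_kernel A) * card ((*\<^sub>v) A ` carrier_vec n) = CARD('a) ^ n"
proof -
  let ?V = "carrier_vec n :: 'a vec set"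
  have fibre: "card {x \<in> ?V. A *\<^sub>v x = y} = card (mat_kernel A)" if y: "y \<in> (*\<^sub>v) A ` ?V" for y
  proof -
    obtain w where w: "w \<in> ?V" "y = A *\<^sub>v w" using y by auto
    show ?thesis
    proof (rule bij_betw_same_card[OF bij_betwI])
      show "(\<lambda>x. x + (- 1) \<cdot>\<^sub>v w) \<in> {x \<in> ?V. A *\<^sub>v x = y} \<rightarrow> mat_kernel A"
        using A w by (auto simp: mat_kernel_def mult_mat_vec_add_smult intro!: eq_vecI)
      show "(\<lambda>x. x + 1 \<cdot>\<^sub>v w) \<in> mat_kernel A \<rightarrow> {x \<in> ?V. A *\<^sub>v x = y}"
        using A w by (auto simp: mat_kernel_def mult_add_distrib_mat_vec[OF A _ w(1)])
    qed (use w A in \<open>auto simp del: one_smult_vec simp: mat_kernel_def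
        intro!: add_smult_uminus_cancel[where n = n]\<close>)
  qed
  have "?V = (\<Union>y\<in>(*\<^sub>v) A ` ?V. {x \<in> ?V. A *\<^sub>v x = y})" by auto
  then have "card ?V = card (\<Union>y\<in>(*\<^sub>v) A ` ?V. {x \<in> ?V. A *\<^sub>v x = y})" by simp
  also have "\<dots> = (\<Sum>y\<in>(*\<^sub>v) A ` ?V. card {x \<in> ?V. A *\<^sub>v x = y})"
    by (intro card_UN_disjoint) auto
  also have "\<dots> = card ((*\<^sub>v) A ` ?V) * card (mat_kernel A)"
    using fibre by simp
  finally show ?thesis by (simp add: card_carrier_vec)
qed

text \<open>A maximal independent set of columns, as the columns of a matrix \<open>B\<close>, gives an injective map onto
the column space of \<open>A\<close>.\<close>

lemma card_image_eq_power_rank: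
  fixes A :: "'a::{field,finite} mat"
  assumes A: "A \<in> carrier_mat m n"
  shows "card ((*\<^sub>v) A ` carrier_vec n) = CARD('a) ^ vec_space.rank m A"
proof -
  interpret vec_space "TYPE('a)" m .
  have cols: "set (cols A) \<subseteq> carrier_vec m" using A cols_dim by blast
  obtain U where U: "maximal U (\<lambda>T. T \<subseteq> set (cols A) \<and> lin_indpt T)" "finite U"
  proof -
    have "lin_indpt {}" using finite_lin_indpt2[of "{}"] by auto
    then show ?thesis
      using maximal_exists_superset[of "set (cols A)" "\<lambda>T. T \<subseteq> set (cols A) \<and> lin_indpt T" "{}"] that
      by auto
  qed
  have Uc: "U \<subseteq> set (cols A)" "lin_indpt U" using U(1) by (auto simp: maximal_def)
  have Um: "U \<subseteq> carrier_vec m" using Uc cols by auto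
  have "set (cols A) \<subseteq> span U"
  proof
    fix a assume a: "a \<in> set (cols A)"
    show "a \<in> span U"
    proof (cases "a \<in> U")
      case True
      then show ?thesis using Um span_mem by auto
    next
      case False
      then have "lin_dep (U \<union> {a})"
        using U(1) a Uc(1) unfolding maximal_def
        by (metis Un_insert_right Un_upper1 insertI1 insert_subset sup_bot.right_neutral)
      then show ?thesis
        using lin_dep_iff_in_span[OF Um Uc(2)] False a cols by auto
    qed
  qed
  then have span: "span (set (cols A)) = span U"
    using Um Uc(1) by (metis span_is_monotone span_is_submodule span_is_subset subset_antisym)
  obtain us where us: "set us = U" "distinct us" using U(2) finite_distinct_list by auto
  define B where "B = mat_of_cols m us"
  have B: "B \<in> carrier_mat m (card U)" "cols B = us"
    using us Um distinct_card[OF us(2)] by (auto simp: B_def)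
  have "inj_on ((*\<^sub>v) B) (carrier_vec (card U))"
  proof (rule inj_onI)
    fix x y assume xy: "x \<in> carrier_vec (card U)" "y \<in> carrier_vec (card U)" "B *\<^sub>v x = B *\<^sub>v y"
    have "B *\<^sub>v (x + (- 1) \<cdot>\<^sub>v y) = 0\<^sub>v m"
      using xy B by (subst mult_mat_vec_add_smult) (auto intro!: eq_vecI)
    then have z: "x + (- 1) \<cdot>\<^sub>v y = 0\<^sub>v (card U)"
      using lin_depI[OF B(1)] us B(2) Uc(2) xy by (metis add_carrier_vec smult_carrier_vec)
    show "x = y"
    proof (rule eq_vecI)
      fix i assume "i < dim_vec y"
      then have "(x + (- 1) \<cdot>\<^sub>v y) $ i = 0" using z xy by simp
      then show "x $ i = y $ i" using \<open>i < dim_vec y\<close> xy by simp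
    qed (use xy in auto)
  qed
  then have "CARD('a) ^ card U = card ((*\<^sub>v) B ` carrier_vec (card U))"
    by (simp add: card_image card_carrier_vec)
  also have "(*\<^sub>v) B ` carrier_vec (card U) = col_space B"
    unfolding col_space_eq[OF B(1)] using B(1) by auto
  also have "\<dots> = col_space A"
    using span us B(2) by (simp add: col_space_def)
  also have "\<dots> = (*\<^sub>v) A ` carrier_vec n"
    unfolding col_space_eq[OF A] using A by auto
  finally show ?thesis using rank_card_indpt[OF A U(1)] by simp
qed

lemma rank_plus_corank:
  assumes "A \<in> carrier_mat n n"
  shows "vec_space.rank n A + corank A = n"
  using vec_space.rank_le_nc[OF assms] assms by (simp add: corank_def)

lemma corank_le:
  assumes "A \<in> carrier_mat n n"
  shows "corank A \<le> n"
  using assms by (simp add: corank_def)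

text \<open>This turns every statement about coranks below into one about cardinalities of kernels.\<close>

lemma card_mat_kernel:
  fixes A :: "'a::{field,finite} mat"
  assumes A: "A \<in> carrier_mat n n"
  shows "card (mat_kernel A) = CARD('a) ^ corank A"
proof -
  let ?r = "vec_space.rank n A"
  have "card (mat_kernel A) * CARD('a) ^ ?r = CARD('a) ^ corank A * CARD('a) ^ ?r"
    using card_kernel_times_image[OF A] card_image_eq_power_rank[OF A] rank_plus_corank[OF A]
    by (simp flip: power_add add: add.commute)
  then show ?thesis by simp
qed

section \<open>Bordering a matrix by one row and column\<close>

definition snoc_vec :: "'a vec \<Rightarrow> 'a \<Rightarrow> 'a vec" where
  "snoc_vec x s = Matrix.vec (Suc (dim_vec x)) (\<lambda>i. if i < dim_vec x then x $ i else s)"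

definition border :: "'a::comm_ring_1 \<Rightarrow> 'a mat \<Rightarrow> 'a vec \<Rightarrow> 'a \<Rightarrow> 'a mat" where
  "border \<epsilon> A v c = Matrix.mat (Suc (dim_row A)) (Suc (dim_row A)) (\<lambda>(i, j).
     if i < dim_row A \<and> j < dim_row A then A $$ (i, j)
     else if i < dim_row A then v $ i
     else if j < dim_row A then \<epsilon> * v $ j
     else c)"

lemma border_carrier:
  "A \<in> carrier_mat n n \<Longrightarrow> border \<epsilon> A v c \<in> carrier_mat (Suc n) (Suc n)"
  by (simp add: border_def)

lemma border_transpose:
  assumes "A \<in> carrier_mat n n" "A\<^sup>T = \<epsilon> \<cdot>\<^sub>m A" "\<epsilon> * \<epsilon> = 1" "\<epsilon> * c = c"
  shows "(border \<epsilon> A v c)\<^sup>T = \<epsilon> \<cdot>\<^sub>m border \<epsilon> A v c"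
proof (rule eq_matI)
  fix i j assume ij: "i < dim_row (\<epsilon> \<cdot>\<^sub>m border \<epsilon> A v c)" "j < dim_col (\<epsilon> \<cdot>\<^sub>m border \<epsilon> A v c)"
  have "A $$ (j, i) = \<epsilon> * A $$ (i, j)" if "i < n" "j < n"
  proof -
    have "A\<^sup>T $$ (i, j) = (\<epsilon> \<cdot>\<^sub>m A) $$ (i, j)" by (simp add: assms(2))
    then show ?thesis using that assms(1) by simp
  qed
  moreover have "\<epsilon> * (\<epsilon> * y) = y" for y
    using assms(3) by (simp flip: mult.assoc)
  ultimately show "(border \<epsilon> A v c)\<^sup>T $$ (i, j) = (\<epsilon> \<cdot>\<^sub>m border \<epsilon> A v c) $$ (i, j)"
    using ij assms(1,4) by (auto simp: border_def)
qed (simp_all add: border_def)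

lemma border_mult_snoc:
  assumes A: "A \<in> carrier_mat n n" and v: "v \<in> carrier_vec n" and x: "x \<in> carrier_vec n"
  shows "border \<epsilon> A v c *\<^sub>v snoc_vec x s
           = snoc_vec (A *\<^sub>v x + s \<cdot>\<^sub>v v) (\<epsilon> * (v \<bullet> x) + s * c)"
proof (rule eq_vecI)
  fix i assume "i < dim_vec (snoc_vec (A *\<^sub>v x + s \<cdot>\<^sub>v v) (\<epsilon> * (v \<bullet> x) + s * c))"
  then have i: "i < Suc n" using A v by (simp add: snoc_vec_def)
  have "(border \<epsilon> A v c *\<^sub>v snoc_vec x s) $ i
          = (\<Sum>j<n. border \<epsilon> A v c $$ (i, j) * x $ j) + border \<epsilon> A v c $$ (i, n) * s"
    using A x i by (simp add: scalar_prod_def border_def snoc_vec_def lessThan_atLeast0)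
  also have "\<dots> = snoc_vec (A *\<^sub>v x + s \<cdot>\<^sub>v v) (\<epsilon> * (v \<bullet> x) + s * c) $ i"
  proof (cases "i < n")
    case True
    then show ?thesis
      using A x v by (simp add: scalar_prod_def border_def snoc_vec_def lessThan_atLeast0 mult.commute)
  next
    case False
    then show ?thesis
      using A x v i
      by (simp add: scalar_prod_def border_def snoc_vec_def lessThan_atLeast0 sum_distrib_left mult_ac)
  qed
  finally show "(border \<epsilon> A v c *\<^sub>v snoc_vec x s) $ i
      = snoc_vec (A *\<^sub>v x + s \<cdot>\<^sub>v v) (\<epsilon> * (v \<bullet> x) + s * c) $ i" .
qed (use A v in \<open>simp add: border_def snoc_vec_def\<close>)

lemma snoc_vec_eq_iff:
  assumes "x \<in> carrier_vec n" "y \<in> carrier_vec n"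
  shows "snoc_vec x s = snoc_vec y t \<longleftrightarrow> x = y \<and> s = t"
proof
  assume eq: "snoc_vec x s = snoc_vec y t"
  have "x $ i = y $ i" if "i < n" for i
  proof -
    have "snoc_vec x s $ i = snoc_vec y t $ i" by (simp only: eq)
    then show ?thesis using that assms by (simp add: snoc_vec_def)
  qed
  moreover have "snoc_vec x s $ n = snoc_vec y t $ n" by (simp only: eq)
  ultimately show "x = y \<and> s = t"
    using assms by (auto simp: snoc_vec_def)
qed simp

lemma zero_vec_Suc: "0\<^sub>v (Suc n) = snoc_vec (0\<^sub>v n) 0"
  by (auto simp: snoc_vec_def)

lemma carrier_vec_Suc:
  "(carrier_vec (Suc n) :: 'a vec set) = (\<lambda>(x, s). snoc_vec x s) ` (carrier_vec n \<times> UNIV)"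
proof (intro equalityI subsetI)
  fix z :: "'a vec" assume z: "z \<in> carrier_vec (Suc n)"
  then have "z = snoc_vec (Matrix.vec n (($) z)) (z $ n)"
    by (auto simp: snoc_vec_def less_Suc_eq)
  then show "z \<in> (\<lambda>(x, s). snoc_vec x s) ` (carrier_vec n \<times> UNIV)"
    by (auto intro!: image_eqI[of _ _ "(Matrix.vec n (($) z), z $ n)"])
qed (auto simp: snoc_vec_def)

lemma card_kernel_border:
  assumes A: "A \<in> carrier_mat n n" and v: "v \<in> carrier_vec n"
  shows "card (mat_kernel (border \<epsilon> A v c))
    = card {(x, s). x \<in> carrier_vec n \<and> A *\<^sub>v x + s \<cdot>\<^sub>v v = 0\<^sub>v n \<and> \<epsilon> * (v \<bullet> x) + s * c = 0}"
    (is "_ = card ?K")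
proof -
  have "mat_kernel (border \<epsilon> A v c) = (\<lambda>(x, s). snoc_vec x s) ` ?K"
  proof -
    have "border \<epsilon> A v c *\<^sub>v snoc_vec x s = 0\<^sub>v (Suc n)
            \<longleftrightarrow> A *\<^sub>v x + s \<cdot>\<^sub>v v = 0\<^sub>v n \<and> \<epsilon> * (v \<bullet> x) + s * c = 0"
      if "x \<in> carrier_vec n" for x s
      unfolding border_mult_snoc[OF A v that] zero_vec_Suc
      using mult_mat_vec_carrier[OF A that] v by (intro snoc_vec_eq_iff[where n = n]) auto
    then show ?thesis
      using border_carrier[OF A, of \<epsilon> v c]
      by (auto simp: mat_kernel_def carrier_vec_Suc)
  qed
  moreover have "inj_on (\<lambda>(x, s). snoc_vec x s) ?K"
    by (auto simp: inj_on_def snoc_vec_eq_iff)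
  ultimately show ?thesis by (simp add: card_image)
qed

lemma transposed_mult_scalar_prod:
  fixes A :: "'a::field mat"
  assumes A: "A \<in> carrier_mat n n" "A\<^sup>T = \<epsilon> \<cdot>\<^sub>m A"
    and "w \<in> carrier_vec n" "y \<in> carrier_vec n"
  shows "w \<bullet> (A *\<^sub>v y) = \<epsilon> * ((A *\<^sub>v w) \<bullet> y)"
proof -
  have "w \<bullet> (A *\<^sub>v y) = (A\<^sup>T *\<^sub>v w) \<bullet> y"
    using transpose_vec_mult_scalar[OF A(1) assms(4,3)] by simp
  also have "A\<^sup>T *\<^sub>v w = \<epsilon> \<cdot>\<^sub>v (A *\<^sub>v w)"
    using assms by (auto intro!: eq_vecI)
  finally show ?thesis using assms by simp
qed

text \<open>The substitution \<open>y = x + s w\<close> decouples the kernel equations of the bordered matrix: they become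
\<open>A y = 0\<close> and \<open>s (c - \<epsilon> (v \<bullet> w)) = 0\<close>, because \<open>v = A w\<close> is orthogonal to the kernel of \<open>A\<close>.\<close>

lemma card_kernel_border_image:
  fixes A :: "'a::{field,finite} mat"
  assumes A: "A \<in> carrier_mat n n" and sym: "A\<^sup>T = \<epsilon> \<cdot>\<^sub>m A" and eps: "\<epsilon> * \<epsilon> = 1"
    and w: "w \<in> carrier_vec n" and v: "v = A *\<^sub>v w"
  shows "card (mat_kernel (border \<epsilon> A v c))
    = (if c = \<epsilon> * (v \<bullet> w) then CARD('a) else 1) * card (mat_kernel A)"
proof -
  let ?K = "{(x, s). x \<in> carrier_vec n \<and> A *\<^sub>v x + s \<cdot>\<^sub>v v = 0\<^sub>v n \<and> \<epsilon> * (v \<bullet> x) + s * c = 0}"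
  let ?L = "mat_kernel A \<times> {s. s * (c - \<epsilon> * (v \<bullet> w)) = 0}"
  have vc: "v \<in> carrier_vec n" using mult_mat_vec_carrier[OF A w] v by simp
  have orth: "v \<bullet> y = 0" if "y \<in> mat_kernel A" for y
  proof -
    have "0 = w \<bullet> (A *\<^sub>v y)" using that A w by (auto simp: mat_kernel_def)
    also have "\<dots> = \<epsilon> * (v \<bullet> y)"
      using transposed_mult_scalar_prod[OF A sym w, of y] that A by (auto simp: mat_kernel_def v)
    finally have "\<epsilon> * (\<epsilon> * (v \<bullet> y)) = 0" by simp
    then show ?thesis using eps by (simp flip: mult.assoc)
  qed
  have ker: "A *\<^sub>v (x + s \<cdot>\<^sub>v w) = A *\<^sub>v x + s \<cdot>\<^sub>v v" if "x \<in> carrier_vec n" for x s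
    unfolding v using that w A by (intro mult_mat_vec_add_smult)
  have dot: "v \<bullet> (x + s \<cdot>\<^sub>v w) = v \<bullet> x + s * (v \<bullet> w)" if "x \<in> carrier_vec n" for x s
    using that w vc by (intro scalar_prod_add_smult)
  have "bij_betw (\<lambda>(x, s). (x + s \<cdot>\<^sub>v w, s)) ?K ?L"
  proof (rule bij_betwI[where g = "\<lambda>(y, s). (y + (- s) \<cdot>\<^sub>v w, s)"])
    show "(\<lambda>(x, s). (x + s \<cdot>\<^sub>v w, s)) \<in> ?K \<rightarrow> ?L"
    proof (clarsimp)
      fix x s assume x: "x \<in> carrier_vec n" "A *\<^sub>v x + s \<cdot>\<^sub>v v = 0\<^sub>v n" "\<epsilon> * (v \<bullet> x) + s * c = 0"
      have k: "x + s \<cdot>\<^sub>v w \<in> mat_kernel A"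
        using x w A ker by (simp add: mat_kernel_def)
      have "v \<bullet> x = - (s * (v \<bullet> w))"
        using orth[OF k] dot[OF x(1)] by (simp add: eq_neg_iff_add_eq_0)
      then have "s * (c - \<epsilon> * (v \<bullet> w)) = 0"
        using x(3) by (simp add: algebra_simps)
      then show "x + s \<cdot>\<^sub>v w \<in> mat_kernel A \<and> (s = 0 \<or> c = \<epsilon> * (v \<bullet> w))"
        using k by simp
    qed
    show "(\<lambda>(y, s). (y + (- s) \<cdot>\<^sub>v w, s)) \<in> ?L \<rightarrow> ?K"
    proof (rule Pi_I)
      fix p assume "p \<in> ?L"
      then obtain y s where p: "p = (y, s)"
        and y: "y \<in> mat_kernel A" "s * (c - \<epsilon> * (v \<bullet> w)) = 0" by auto
      then have yc: "y \<in> carrier_vec n" "A *\<^sub>v y = 0\<^sub>v n" using A by (auto simp: mat_kernel_def)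
      have "A *\<^sub>v (y + (- s) \<cdot>\<^sub>v w) + s \<cdot>\<^sub>v v = 0\<^sub>v n"
        using ker[OF yc(1), of "- s"] yc vc by auto
      moreover have "\<epsilon> * (v \<bullet> (y + (- s) \<cdot>\<^sub>v w)) + s * c = 0"
        using dot[OF yc(1), of "- s"] orth[OF y(1)] y(2) by (simp add: algebra_simps)
      ultimately show "(case p of (y, s) \<Rightarrow> (y + (- s) \<cdot>\<^sub>v w, s)) \<in> ?K"
        using yc w p by simp
    qed
  qed (use w A in \<open>auto intro!: add_smult_uminus_cancel[where n = n] simp: mat_kernel_def\<close>)
  then have "card ?K = card ?L" by (rule bij_betw_same_card)
  also have "{s. s * (c - \<epsilon> * (v \<bullet> w)) = 0} = (if c = \<epsilon> * (v \<bullet> w) then UNIV else {0})"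
    by auto
  finally show ?thesis
    by (simp add: card_kernel_border[OF A vc] card_cartesian_product)
qed

text \<open>The image is orthogonal to the kernel by \<open>\<epsilon>\<close>-symmetry, and both sides have \<open>q\<^sup>n\<close> divided by the
size of the kernel as their cardinality.\<close>

lemma image_eq_kernel_orthogonal:
  fixes A :: "'a::{field,finite} mat"
  assumes A: "A \<in> carrier_mat n n" and sym: "A\<^sup>T = \<epsilon> \<cdot>\<^sub>m A" and eps: "\<epsilon> * \<epsilon> = 1"
  shows "(*\<^sub>v) A ` carrier_vec n = {v \<in> carrier_vec n. \<forall>x\<in>mat_kernel A. v \<bullet> x = 0}"
    (is "?I = ?O")
proof (rule card_subset_eq)
  show "finite ?O" by simp
  show "?I \<subseteq> ?O"
  proof clarsimp
    fix w :: "'a vec" assume w: "w \<in> carrier_vec n"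
    have "(A *\<^sub>v w) \<bullet> y = 0" if "y \<in> mat_kernel A" for y
    proof -
      have "0 = w \<bullet> (A *\<^sub>v y)" using that A w by (auto simp: mat_kernel_def)
      also have "\<dots> = \<epsilon> * ((A *\<^sub>v w) \<bullet> y)"
        using transposed_mult_scalar_prod[OF A sym w, of y] that A by (auto simp: mat_kernel_def)
      finally have "\<epsilon> * (\<epsilon> * ((A *\<^sub>v w) \<bullet> y)) = 0" by simp
      then show ?thesis using eps by (simp flip: mult.assoc)
    qed
    then show "A *\<^sub>v w \<in> carrier_vec n \<and> (\<forall>x\<in>mat_kernel A. (A *\<^sub>v w) \<bullet> x = 0)"
      using mult_mat_vec_carrier[OF A w] by simp
  qed
  have "card (mat_kernel A) * card ?O = CARD('a) ^ n"
    using A by (intro card_orthogonal_complement)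
      (auto simp: mat_kernel_def mult_mat_vec_add_smult)
  then have "card (mat_kernel A) * card ?O = card (mat_kernel A) * card ?I"
    by (simp add: card_kernel_times_image[OF A])
  then show "card ?I = card ?O"
    by (simp add: card_mat_kernel[OF A])
qed

text \<open>If \<open>v\<close> is outside the image, the last coordinate of a kernel vector of the bordered matrix must be
\<open>0\<close>; what remains is the part of the kernel of \<open>A\<close> orthogonal to \<open>v\<close>, and \<open>v\<close> is not orthogonal
to the whole kernel.\<close>

lemma card_kernel_border_not_image:
  fixes A :: "'a::{field,finite} mat"
  assumes A: "A \<in> carrier_mat n n" and sym: "A\<^sup>T = \<epsilon> \<cdot>\<^sub>m A" and eps: "\<epsilon> * \<epsilon> = 1"
    and v: "v \<in> carrier_vec n" "v \<notin> (*\<^sub>v) A ` carrier_vec n"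
  shows "CARD('a) * card (mat_kernel (border \<epsilon> A v c)) = card (mat_kernel A)"
proof -
  let ?K = "{(x, s). x \<in> carrier_vec n \<and> A *\<^sub>v x + s \<cdot>\<^sub>v v = 0\<^sub>v n \<and> \<epsilon> * (v \<bullet> x) + s * c = 0}"
  have eps0: "\<epsilon> \<noteq> 0" using eps by auto
  have "s = 0" if x: "x \<in> carrier_vec n" "A *\<^sub>v x + s \<cdot>\<^sub>v v = 0\<^sub>v n" for x s
  proof (rule ccontr)
    assume s: "s \<noteq> 0"
    have "v = A *\<^sub>v ((- 1 / s) \<cdot>\<^sub>v x)"
    proof (rule eq_vecI)
      fix i assume "i < dim_vec (A *\<^sub>v ((- 1 / s) \<cdot>\<^sub>v x))"
      then have i: "i < n" using A by simp
      have "(A *\<^sub>v x + s \<cdot>\<^sub>v v) $ i = 0" using x(2) i by simp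
      then have "(A *\<^sub>v x) $ i = - (s * v $ i)"
        using i A v by (simp add: eq_neg_iff_add_eq_0)
      moreover have "(A *\<^sub>v ((- 1 / s) \<cdot>\<^sub>v x)) $ i = (- 1 / s) * (A *\<^sub>v x) $ i"
        using i A x by (simp add: Matrix.mult_mat_vec)
      ultimately show "v $ i = (A *\<^sub>v ((- 1 / s) \<cdot>\<^sub>v x)) $ i"
        using s by (simp add: field_simps)
    qed (use v A in auto)
    then show False using v(2) x(1) by auto
  qed
  moreover have "A *\<^sub>v x + 0 \<cdot>\<^sub>v v = A *\<^sub>v x" if "x \<in> carrier_vec n" for x
    using A v(1) by (intro eq_vecI) auto
  ultimately have "?K = {x \<in> mat_kernel A. v \<bullet> x = 0} \<times> {0}"
    using A eps0 by (fastforce simp: mat_kernel_def)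
  then have "card (mat_kernel (border \<epsilon> A v c)) = card {x \<in> mat_kernel A. v \<bullet> x = 0}"
    by (simp add: card_kernel_border[OF A v(1)] card_cartesian_product)
  moreover obtain x0 where x0: "x0 \<in> mat_kernel A" "v \<bullet> x0 \<noteq> 0"
    using v image_eq_kernel_orthogonal[OF A sym eps] by blast
  have "CARD('a) * card {x \<in> mat_kernel A. v \<bullet> x = 0} = card (mat_kernel A)"
    using A by (intro card_functional_kernel[where n = n and ?x0.0 = x0] v(1) x0)
      (auto simp: mat_kernel_def mult_mat_vec_add_smult)
  ultimately show ?thesis by simp
qed

lemma corank_border_image:
  fixes A :: "'a::{field,finite} mat"
  assumes A: "A \<in> carrier_mat n n" and sym: "A\<^sup>T = \<epsilon> \<cdot>\<^sub>m A" and eps: "\<epsilon> * \<epsilon> = 1"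
    and w: "w \<in> carrier_vec n"
  shows "corank (border \<epsilon> A (A *\<^sub>v w) c)
    = (if c = \<epsilon> * ((A *\<^sub>v w) \<bullet> w) then corank A + 1 else corank A)"
proof -
  have "CARD('a) ^ corank (border \<epsilon> A (A *\<^sub>v w) c)
      = CARD('a) ^ (if c = \<epsilon> * ((A *\<^sub>v w) \<bullet> w) then corank A + 1 else corank A)"
    using card_kernel_border_image[OF A sym eps w refl, of c]
    by (simp add: card_mat_kernel[OF A] card_mat_kernel[OF border_carrier[OF A]])
  then show ?thesis
    using card_field_ge_2[where 'a = 'a] by (subst (asm) power_inject_exp) auto
qed

lemma corank_border_not_image:
  fixes A :: "'a::{field,finite} mat"
  assumes A: "A \<in> carrier_mat n n" and sym: "A\<^sup>T = \<epsilon> \<cdot>\<^sub>m A" and eps: "\<epsilon> * \<epsilon> = 1"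
    and v: "v \<in> carrier_vec n" "v \<notin> (*\<^sub>v) A ` carrier_vec n"
  shows "corank A = Suc (corank (border \<epsilon> A v c))"
proof -
  have "CARD('a) ^ corank A = CARD('a) ^ Suc (corank (border \<epsilon> A v c))"
    using card_kernel_border_not_image[OF A sym eps v, of c]
    by (simp add: card_mat_kernel[OF A] card_mat_kernel[OF border_carrier[OF A]])
  then show ?thesis
    using card_field_ge_2[where 'a = 'a] by (subst (asm) power_inject_exp) auto
qed

section \<open>The corank walk and its contraction\<close>

text \<open>The transition operator of the corank under bordering, acting on test functions: from \<open>k\<close> the walk
goes down with probability \<open>1 - 1 / q ^ k\<close>; otherwise it goes up with probability \<open>1 / c\<close> and stays
with probability \<open>1 - 1 / c\<close>. At \<open>k = 0\<close> the truncated \<open>k - 1\<close> has weight \<open>0\<close>.\<close>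

definition corank_walk :: "real \<Rightarrow> real \<Rightarrow> (nat \<Rightarrow> real) \<Rightarrow> nat \<Rightarrow> real" where
  "corank_walk q c f k =
     (1 - 1 / q ^ k) * f (k - 1) + 1 / q ^ k * ((1 - 1 / c) * f k + 1 / c * f (k + 1))"

text \<open>The symmetric and the alternating case. The coranks that occur at a given size lie in one residue
class modulo \<open>d\<close>.\<close>

definition walk_type :: "real \<Rightarrow> real \<Rightarrow> nat \<Rightarrow> bool" where
  "walk_type q c d \<longleftrightarrow> q \<ge> 2 \<and> (c = q \<and> d = 1 \<or> c = 1 \<and> d = 2)"

text \<open>The monotone coupling of two walks at distance \<open>d\<close>, read on test functions. The weights on the
right are nonnegative, and no term for the difference at \<open>k\<close> itself appears; this fails for
\<open>d = 1\<close> in the alternating case, where neighbouring walks never meet.\<close>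

lemma corank_walk_diff:
  assumes "walk_type q c d"
  shows "corank_walk q c f (k + d) - corank_walk q c f k
    = (1 - 1 / q ^ k) * (f (k - 1 + d) - f (k - 1)) + 1 / q ^ (k + 2) * (f (k + 1 + d) - f (k + 1))"
proof -
  define y r where "y = 1 / q ^ k" and "r = 1 / q"
  have y: "1 / q ^ (k + 1) = y * r" "1 / q ^ (k + 2) = y * r * r"
    by (simp_all add: y_def r_def)
  have down: "(1 - y) * f (k - 1 + d) = (1 - y) * f (k + d - 1)"
    by (cases k) (auto simp: y_def)
  consider "c = q" "d = 1" | "c = 1" "d = 2"
    using assms by (auto simp: walk_type_def)
  then show ?thesis
  proof cases
    case 1
    have "1 / q ^ (k + d) = y * r" "1 / c = r" using y 1 by (simp_all add: r_def)
    then show ?thesis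
      unfolding corank_walk_def right_diff_distrib y y_def[symmetric] down
      by (simp add: 1 algebra_simps)
  next
    case 2
    have "1 / q ^ (k + d) = y * r * r" "1 / c = 1" using y 2 by simp_all
    then show ?thesis
      unfolding corank_walk_def right_diff_distrib y y_def[symmetric] down
      by (simp add: 2 algebra_simps numeral_2_eq_2)
  qed
qed

text \<open>The weight \<open>q ^ k\<close> is an eigenfunction of the operator on differences:
\<open>(1 - 1 / q ^ k) q ^ (k - 1) + q ^ (k + 1) / q ^ (k + 2) = q ^ k / q\<close>.\<close>

lemma corank_walk_contraction:
  assumes w: "walk_type q c d" and f: "\<And>k. \<bar>f (k + d) - f k\<bar> \<le> B * q ^ k"
  shows "\<bar>corank_walk q c f (k + d) - corank_walk q c f k\<bar> \<le> B / q * q ^ k"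
proof -
  have q: "q \<ge> 2" using w by (simp add: walk_type_def)
  have y: "0 < 1 / q ^ k" "1 / q ^ k \<le> 1" using q by auto
  have "\<bar>corank_walk q c f (k + d) - corank_walk q c f k\<bar>
      \<le> (1 - 1 / q ^ k) * \<bar>f (k - 1 + d) - f (k - 1)\<bar> + 1 / q ^ (k + 2) * \<bar>f (k + 1 + d) - f (k + 1)\<bar>"
    unfolding corank_walk_diff[OF w] using y q
    by (intro order_trans[OF abs_triangle_ineq]) (simp add: abs_mult)
  also have "(1 - 1 / q ^ k) * \<bar>f (k - 1 + d) - f (k - 1)\<bar> \<le> (1 - 1 / q ^ k) * (B * q ^ k / q)"
  proof (cases k)
    case (Suc j)
    then show ?thesis using f[of j] q y by (intro mult_left_mono) auto
  qed simp
  also have "1 / q ^ (k + 2) * \<bar>f (k + 1 + d) - f (k + 1)\<bar> \<le> 1 / q ^ (k + 2) * (B * q ^ (k + 1))"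
    using f[of "k + 1"] q by (intro mult_left_mono) auto
  also have "(1 - 1 / q ^ k) * (B * q ^ k / q) + 1 / q ^ (k + 2) * (B * q ^ (k + 1)) = B / q * q ^ k"
    using q by (simp add: field_simps)
  finally show ?thesis by simp
qed

lemma corank_walk_iterate_contraction:
  assumes w: "walk_type q c d" and f: "\<And>k. \<bar>f (k + d) - f k\<bar> \<le> B * q ^ k"
  shows "\<bar>(corank_walk q c ^^ t) f (k + d) - (corank_walk q c ^^ t) f k\<bar> \<le> B / q ^ t * q ^ k"
proof (induction t arbitrary: k)
  case (Suc t)
  from corank_walk_contraction[OF w this] show ?case by (simp add: mult_ac)
qed (use f in simp)

lemma corank_walk_bounded:
  assumes w: "walk_type q c d" and f: "\<And>k. \<bar>f k\<bar> \<le> B"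
  shows "\<bar>corank_walk q c f k\<bar> \<le> B"
proof -
  define y z where "y = 1 / q ^ k" and "z = 1 / c"
  have yz: "0 \<le> y" "y \<le> 1" "0 \<le> z" "z \<le> 1"
    using w by (auto simp: walk_type_def y_def z_def)
  have "\<bar>corank_walk q c f k\<bar> = \<bar>(1 - y) * f (k - 1) + (y * (1 - z) * f k + y * z * f (k + 1))\<bar>"
    by (simp add: corank_walk_def y_def z_def algebra_simps add_divide_distrib diff_divide_distrib)
  also have "\<dots> \<le> \<bar>(1 - y) * f (k - 1)\<bar> + (\<bar>y * (1 - z) * f k\<bar> + \<bar>y * z * f (k + 1)\<bar>)"
    by linarith
  also have "\<dots> = (1 - y) * \<bar>f (k - 1)\<bar> + (y * (1 - z) * \<bar>f k\<bar> + y * z * \<bar>f (k + 1)\<bar>)"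
    using yz by (simp add: abs_mult)
  also have "\<dots> \<le> (1 - y) * B + (y * (1 - z) * B + y * z * B)"
    using yz by (intro add_mono mult_left_mono f) auto
  also have "\<dots> = B" by (simp add: algebra_simps)
  finally show ?thesis .
qed

lemma corank_walk_iterate_bounded:
  assumes "walk_type q c d" and "\<And>k. \<bar>f k\<bar> \<le> B"
  shows "\<bar>(corank_walk q c ^^ t) f k\<bar> \<le> B"
proof (induction t arbitrary: k)
  case (Suc t)
  show ?case using corank_walk_bounded[OF assms(1) Suc.IH] by simp
qed (use assms in simp)

text \<open>Telescoping in steps of \<open>d\<close> gives \<open>B \<bar>q ^ x - q ^ y\<bar>\<close> on the right; the larger bound stated here
has no absolute value and can be averaged over \<open>y\<close>. Subtracting \<open>2\<close> is what later makes
the constant in front of \<open>q ^ x\<close> equal to \<open>1\<close>.\<close>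

lemma diff_le_of_step_bound:
  fixes q :: real
  assumes q: "q \<ge> 1" and f: "\<And>k. \<bar>f (k + d) - f k\<bar> \<le> B * q ^ k" and B: "B \<ge> 0"
    and cong: "x mod d = y mod d"
  shows "\<bar>f x - f y\<bar> * (q ^ d - 1) \<le> B * (q ^ x + q ^ y - 2)"
proof -
  have qd: "q ^ d - 1 \<ge> 0" using q by simp
  have up: "\<bar>f (k + j * d) - f k\<bar> * (q ^ d - 1) \<le> B * (q ^ (k + j * d) - q ^ k)" for k j
  proof (induction j)
    case (Suc j)
    let ?m = "k + j * d"
    have "\<bar>f (k + Suc j * d) - f k\<bar> \<le> \<bar>f (?m + d) - f ?m\<bar> + \<bar>f ?m - f k\<bar>"
      by (simp add: add_ac)
    then have "\<bar>f (k + Suc j * d) - f k\<bar> * (q ^ d - 1)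
        \<le> (\<bar>f (?m + d) - f ?m\<bar> + \<bar>f ?m - f k\<bar>) * (q ^ d - 1)"
      using qd by (rule mult_right_mono)
    also have "\<dots> \<le> B * q ^ ?m * (q ^ d - 1) + B * (q ^ ?m - q ^ k)"
      unfolding distrib_right using qd by (intro add_mono mult_right_mono f Suc.IH)
    also have "\<dots> = B * (q ^ (k + Suc j * d) - q ^ k)"
      by (simp add: algebra_simps power_add)
    finally show ?case .
  qed simp
  have le: "\<bar>f y - f x\<bar> * (q ^ d - 1) \<le> B * (q ^ x + q ^ y - 2)" if "x \<le> y" "x mod d = y mod d" for x y
  proof -
    have "d dvd y - x" using that mod_eq_dvd_iff_nat[of x y d] by simp
    then obtain j where "y - x = d * j" by (auto simp: dvd_def)
    then have "y = x + j * d" using that by (simp add: mult.commute)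
    then have "\<bar>f y - f x\<bar> * (q ^ d - 1) \<le> B * (q ^ y - q ^ x)" using up by simp
    also have "\<dots> \<le> B * (q ^ x + q ^ y - 2)"
      using B one_le_power[OF q, of x] by (intro mult_left_mono) auto
    finally show ?thesis .
  qed
  show ?thesis
  proof (cases "x \<le> y")
    case True
    then show ?thesis using le[of x y] cong by (simp only: abs_minus_commute[of "f x"])
  next
    case False
    then have "\<bar>f x - f y\<bar> * (q ^ d - 1) \<le> B * (q ^ y + q ^ x - 2)" using le[of y x] cong by simp
    then show ?thesis by (simp only: add.commute[of "q ^ x"])
  qed
qed

section \<open>Stationary laws of the corank walk\<close>

text \<open>Detailed balance along the edge from \<open>k\<close> to \<open>k + 1\<close>, multiplied by \<open>q ^ (k + 1)\<close>: the flow
\<open>\<pi> k / (c q ^ k)\<close> upwards equals the flow \<open>\<pi>' (k + 1) (1 - 1 / q ^ (k + 1))\<close> downwards. The two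
laws differ in the alternating case, where a step changes the parity.\<close>

definition corank_balanced :: "real \<Rightarrow> real \<Rightarrow> nat pmf \<Rightarrow> nat pmf \<Rightarrow> bool" where
  "corank_balanced q c \<pi> \<pi>' \<longleftrightarrow> (\<forall>k. pmf \<pi>' (k + 1) * (q ^ (k + 1) - 1) = q / c * pmf \<pi> k)"

lemma expectation_nat_sums:
  fixes f :: "nat \<Rightarrow> real"
  assumes "\<And>k. \<bar>f k\<bar> \<le> B"
  shows "(\<lambda>k. pmf p k * f k) sums measure_pmf.expectation p f"
proof -
  have "integrable (measure_pmf p) f"
    using assms by (intro measure_pmf.integrable_const_bound[where B = B]) auto
  then have "integrable (count_space UNIV) (\<lambda>k. pmf p k * f k)"
    by (simp add: measure_pmf_eq_density integrable_density)
  moreover have "measure_pmf.expectation p f = (\<integral>k. pmf p k * f k \<partial>count_space UNIV)"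
    by (simp add: measure_pmf_eq_density integral_density)
  ultimately show ?thesis
    using sums_integral_count_space_nat by metis
qed

lemma sums_shift_zero:
  fixes g :: "nat \<Rightarrow> real"
  assumes "g sums s" "h 0 = 0" "\<And>k. h (Suc k) = g k"
  shows "h sums s"
  using assms sums_Suc_imp[of h s] by simp

text \<open>The expectation under \<open>\<pi>\<close> splits into the downward, the staying and the upward part of the walk. By
balance, the first becomes the upward probability at \<open>k\<close> under \<open>\<pi>'\<close> and the last the downward one,
after a shift of the index; the three probabilities add up to \<open>1\<close>. The staying part needs
\<open>\<pi> = \<pi>'\<close> unless its probability is \<open>0\<close>.\<close>

lemma corank_walk_stationary:
  assumes w: "walk_type q c d"
    and bal: "corank_balanced q c \<pi> \<pi>'" "corank_balanced q c \<pi>' \<pi>"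
    and lazy: "c = 1 \<or> \<pi>' = \<pi>"
    and f: "\<And>k. \<bar>f k\<bar> \<le> B"
  shows "measure_pmf.expectation \<pi> (corank_walk q c f) = measure_pmf.expectation \<pi>' f"
proof -
  have q: "q > 0" "c > 0" using w by (auto simp: walk_type_def)
  have y: "0 < 1 / q ^ k" "1 / q ^ k \<le> 1" for k
    using w by (auto simp: walk_type_def)
  have z: "0 < 1 / c" "1 / c \<le> 1" using w by (auto simp: walk_type_def)
  have bnd: "\<bar>u * f k\<bar> \<le> B" if "0 \<le> u" "u \<le> 1" for u k
  proof -
    have "\<bar>u * f k\<bar> \<le> 1 * B" unfolding abs_mult using that f[of k] by (intro mult_mono) auto
    then show ?thesis by simp
  qed
  have b1: "\<bar>1 / c * (1 / q ^ k) * f k\<bar> \<le> B" for k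
    using y[of k] z by (intro bnd mult_le_one) auto
  have b2: "\<bar>(1 - 1 / c) * (1 / q ^ k) * f k\<bar> \<le> B" for k
    using y[of k] z by (intro bnd mult_le_one) auto
  have b3: "\<bar>(1 - 1 / q ^ k) * f k\<bar> \<le> B" for k
    using y[of k] by (intro bnd) auto
  define E where "E = (\<lambda>g. measure_pmf.expectation \<pi>' (g :: nat \<Rightarrow> real))"
  have down: "(\<lambda>k. pmf \<pi> k * ((1 - 1 / q ^ k) * f (k - 1))) sums E (\<lambda>k. 1 / c * (1 / q ^ k) * f k)"
  proof (rule sums_shift_zero[OF expectation_nat_sums[OF b1, of \<pi>', folded E_def]])
    fix k
    have "pmf \<pi> (Suc k) * (1 - 1 / q ^ Suc k) = pmf \<pi> (k + 1) * (q ^ (k + 1) - 1) / q ^ Suc k"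
      using q by (simp add: field_simps)
    also have "\<dots> = pmf \<pi>' k * (1 / c * (1 / q ^ k))"
      using bal(2) q by (simp add: corank_balanced_def)
    finally show "pmf \<pi> (Suc k) * ((1 - 1 / q ^ Suc k) * f (Suc k - 1))
        = pmf \<pi>' k * (1 / c * (1 / q ^ k) * f k)"
      by (simp add: mult.assoc[symmetric])
  qed simp
  have stay: "(\<lambda>k. pmf \<pi> k * ((1 - 1 / c) * (1 / q ^ k) * f k))
      sums E (\<lambda>k. (1 - 1 / c) * (1 / q ^ k) * f k)"
    using expectation_nat_sums[OF b2, of \<pi>', folded E_def] lazy by auto
  have "(\<lambda>k. pmf \<pi>' k * ((1 - 1 / q ^ k) * f k)) sums E (\<lambda>k. (1 - 1 / q ^ k) * f k)"
    by (rule expectation_nat_sums[OF b3, of \<pi>', folded E_def])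
  then have "(\<lambda>k. pmf \<pi>' (Suc k) * ((1 - 1 / q ^ Suc k) * f (Suc k)))
      sums E (\<lambda>k. (1 - 1 / q ^ k) * f k)"
    by (subst sums_Suc_iff) simp
  also have "(\<lambda>k. pmf \<pi>' (Suc k) * ((1 - 1 / q ^ Suc k) * f (Suc k)))
      = (\<lambda>k. pmf \<pi> k * (1 / c * (1 / q ^ k) * f (k + 1)))"
  proof
    fix k
    have "pmf \<pi>' (Suc k) * (1 - 1 / q ^ Suc k) = pmf \<pi>' (k + 1) * (q ^ (k + 1) - 1) / q ^ Suc k"
      using q by (simp add: field_simps)
    also have "\<dots> = pmf \<pi> k * (1 / c * (1 / q ^ k))"
      using bal(1) q by (simp add: corank_balanced_def)
    finally show "pmf \<pi>' (Suc k) * ((1 - 1 / q ^ Suc k) * f (Suc k))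
        = pmf \<pi> k * (1 / c * (1 / q ^ k) * f (k + 1))"
      by (simp add: mult.assoc[symmetric])
  qed
  finally have up: "(\<lambda>k. pmf \<pi> k * (1 / c * (1 / q ^ k) * f (k + 1)))
      sums E (\<lambda>k. (1 - 1 / q ^ k) * f k)" .
  have "(\<lambda>k. pmf \<pi> k * corank_walk q c f k) =
     (\<lambda>k. pmf \<pi> k * ((1 - 1 / q ^ k) * f (k - 1)) + pmf \<pi> k * ((1 - 1 / c) * (1 / q ^ k) * f k)
        + pmf \<pi> k * (1 / c * (1 / q ^ k) * f (k + 1)))"
    by (simp add: corank_walk_def algebra_simps add_divide_distrib diff_divide_distrib)
  then have "(\<lambda>k. pmf \<pi> k * corank_walk q c f k) sums
      (E (\<lambda>k. 1 / c * (1 / q ^ k) * f k) + E (\<lambda>k. (1 - 1 / c) * (1 / q ^ k) * f k)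
        + E (\<lambda>k. (1 - 1 / q ^ k) * f k))"
    using sums_add[OF sums_add[OF down stay] up] by simp
  moreover have "(\<lambda>k. pmf \<pi>' k * f k) = (\<lambda>k. pmf \<pi>' k * (1 / c * (1 / q ^ k) * f k)
      + pmf \<pi>' k * ((1 - 1 / c) * (1 / q ^ k) * f k) + pmf \<pi>' k * ((1 - 1 / q ^ k) * f k))"
  proof
    fix k
    define y z where "y = 1 / q ^ k" and "z = 1 / c"
    show "pmf \<pi>' k * f k = pmf \<pi>' k * (1 / c * (1 / q ^ k) * f k)
      + pmf \<pi>' k * ((1 - 1 / c) * (1 / q ^ k) * f k) + pmf \<pi>' k * ((1 - 1 / q ^ k) * f k)"
      unfolding y_def[symmetric] z_def[symmetric] by (simp add: algebra_simps)
  qed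
  then have "(\<lambda>k. pmf \<pi>' k * f k) sums
      (E (\<lambda>k. 1 / c * (1 / q ^ k) * f k) + E (\<lambda>k. (1 - 1 / c) * (1 / q ^ k) * f k)
        + E (\<lambda>k. (1 - 1 / q ^ k) * f k))"
    using sums_add[OF sums_add[OF expectation_nat_sums[OF b1, of \<pi>'] expectation_nat_sums[OF b2, of \<pi>']]
        expectation_nat_sums[OF b3, of \<pi>']]
    unfolding E_def by simp
  moreover note expectation_nat_sums[OF f, of \<pi>']
  moreover note expectation_nat_sums[OF corank_walk_bounded[OF w f], of \<pi>]
  ultimately show ?thesis by (simp add: sums_iff)
qed

lemma corank_walk_iterate_stationary:
  assumes w: "walk_type q c d"
    and bal: "\<And>n. corank_balanced q c (\<pi> n) (\<pi> (Suc n))" "\<And>n. corank_balanced q c (\<pi> (Suc n)) (\<pi> n)"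
    and lazy: "\<And>n. c = 1 \<or> \<pi> (Suc n) = \<pi> n"
    and f: "\<And>k. \<bar>f k\<bar> \<le> B"
  shows "measure_pmf.expectation (\<pi> m) ((corank_walk q c ^^ t) f) = measure_pmf.expectation (\<pi> (m + t)) f"
proof (induction t arbitrary: m)
  case (Suc t)
  have "measure_pmf.expectation (\<pi> m) ((corank_walk q c ^^ Suc t) f)
      = measure_pmf.expectation (\<pi> (Suc m)) ((corank_walk q c ^^ t) f)"
    using corank_walk_stationary[OF w bal(1)[of m] bal(2)[of m] lazy[of m],
        of "(corank_walk q c ^^ t) f", OF corank_walk_iterate_bounded[OF w f]]
    by simp
  then show ?case using Suc.IH[of "Suc m"] by simp
qed simp

text \<open>By balance, \<open>\<pi>' k (q ^ k - 1)\<close> is \<open>q / c\<close> times the mass \<open>\<pi> (k - 1)\<close> for \<open>k > 0\<close>, and \<open>0\<close> for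
\<open>k = 0\<close>, so the sum over \<open>k\<close> of these
terms is \<open>q / c\<close>.\<close>

lemma sums_pmf_power:
  assumes "corank_balanced q c \<pi> \<pi>'"
  shows "(\<lambda>k. pmf \<pi>' k * q ^ k) sums (1 + q / c)"
proof -
  have one: "(\<lambda>k. pmf p k) sums 1" for p :: "nat pmf"
    using expectation_nat_sums[of "\<lambda>_. 1" 1 p] by simp
  have "(\<lambda>k. pmf \<pi>' k * (q ^ k - 1)) sums (q / c)"
    by (rule sums_shift_zero[of "\<lambda>k. q / c * pmf \<pi> k"])
      (use sums_mult[OF one[of \<pi>], of "q / c"] assms in \<open>auto simp: corank_balanced_def\<close>)
  from sums_add[OF one[of \<pi>'] this] show ?thesis by (simp add: algebra_simps)
qed

text \<open>Averaging \<open>diff_le_of_step_bound\<close> over \<open>\<pi>\<close> gives the factor \<open>q ^ x + (1 + q / c) - 2\<close>. Here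
\<open>1 + q / c\<close> is \<open>2\<close> for \<open>d = 1\<close> and \<open>q + 1\<close> for \<open>d = 2\<close>, so at most \<open>q ^ d\<close>, and division by
\<open>q ^ d - 1\<close> leaves at most \<open>q ^ x\<close>.\<close>

lemma expectation_diff_le:
  assumes w: "walk_type q c d" and bal: "corank_balanced q c \<pi>' \<pi>"
    and cong: "\<And>k. pmf \<pi> k \<noteq> 0 \<Longrightarrow> x mod d = k mod d"
    and f: "\<And>k. \<bar>f (k + d) - f k\<bar> \<le> B * q ^ k" and B: "B \<ge> 0"
    and bounded: "\<And>k. \<bar>f k\<bar> \<le> B'"
  shows "\<bar>f x - measure_pmf.expectation \<pi> f\<bar> \<le> B * q ^ x"
proof -
  have q: "q \<ge> 2" and cd: "1 + q / c \<le> q ^ d"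
  proof -
    show "q \<ge> 2" using w by (simp add: walk_type_def)
    then have "q * 2 \<le> q * q" by (intro mult_left_mono) auto
    then have "1 + q \<le> q * q" using \<open>q \<ge> 2\<close> by linarith
    then show "1 + q / c \<le> q ^ d" using w by (auto simp: walk_type_def power2_eq_square)
  qed
  have qd: "q ^ d - 1 > 0" using cd w by (auto simp: walk_type_def power2_eq_square)
  have one: "(\<lambda>k. pmf \<pi> k) sums 1"
    using expectation_nat_sums[of "\<lambda>_. 1" 1 \<pi>] by simp
  have term_le: "\<bar>pmf \<pi> k * (f x - f k)\<bar> * (q ^ d - 1) \<le> pmf \<pi> k * (B * (q ^ x + q ^ k - 2))" for k
  proof (cases "pmf \<pi> k = 0")
    case False
    then have "\<bar>f x - f k\<bar> * (q ^ d - 1) \<le> B * (q ^ x + q ^ k - 2)"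
      using q f B cong by (intro diff_le_of_step_bound) auto
    from mult_left_mono[OF this pmf_nonneg[of \<pi> k]] show ?thesis
      by (simp add: abs_mult mult.assoc)
  qed simp
  have upper: "(\<lambda>k. pmf \<pi> k * (B * (q ^ x + q ^ k - 2))) sums (B * ((q ^ x - 2) * 1 + (1 + q / c)))"
    using sums_mult[OF sums_add[OF sums_mult[OF one, of "q ^ x - 2"] sums_pmf_power[OF bal]], of B]
    by (simp add: algebra_simps)
  have diff: "(\<lambda>k. pmf \<pi> k * (f x - f k)) sums (f x - measure_pmf.expectation \<pi> f)"
    using sums_diff[OF sums_mult2[OF one, of "f x"] expectation_nat_sums[of f, OF bounded, of \<pi>]]
    by (simp add: algebra_simps)
  then have d2: "(\<lambda>k. pmf \<pi> k * (f x - f k) * (q ^ d - 1))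
      sums ((f x - measure_pmf.expectation \<pi> f) * (q ^ d - 1))"
    by (rule sums_mult2)
  have "\<bar>f x - measure_pmf.expectation \<pi> f\<bar> * (q ^ d - 1)
      = norm ((f x - measure_pmf.expectation \<pi> f) * (q ^ d - 1))"
    using qd by (simp add: abs_mult)
  also have "\<dots> \<le> B * ((q ^ x - 2) * 1 + (1 + q / c))"
    unfolding sums_unique[OF d2] sums_unique[OF upper]
    using term_le qd by (intro norm_suminf_le sums_summable[OF upper]) (simp add: abs_mult)
  also have "\<dots> \<le> B * (q ^ x * (q ^ d - 1))"
  proof (rule mult_left_mono[OF _ B])
    have "1 * (q ^ d - 2) \<le> q ^ x * (q ^ d - 2)"
      using q cd w by (intro mult_right_mono) (auto simp: walk_type_def)
    then show "(q ^ x - 2) * 1 + (1 + q / c) \<le> q ^ x * (q ^ d - 1)"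
      using cd by (simp add: algebra_simps)
  qed
  finally have "\<bar>f x - measure_pmf.expectation \<pi> f\<bar> * (q ^ d - 1) \<le> B * q ^ x * (q ^ d - 1)"
    by (simp add: mult.assoc)
  then show ?thesis using qd by simp
qed

section \<open>Coranks of randomly bordered matrices\<close>

text \<open>The corners for which bordering preserves \<open>A\<^sup>T = \<epsilon> A\<close>.\<close>

abbreviation border_corners :: "'a::comm_ring_1 \<Rightarrow> 'a set" where
  "border_corners \<epsilon> \<equiv> {c. \<epsilon> * c = c}"

abbreviation random_border :: "'a::{field,finite} \<Rightarrow> 'a mat \<Rightarrow> 'a mat pmf" where
  "random_border \<epsilon> A \<equiv> map_pmf (\<lambda>(v, c). border \<epsilon> A v c)
     (pmf_of_set (carrier_vec (dim_row A) \<times> border_corners \<epsilon>))"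

lemma finite_nonempty_borders:
  fixes \<epsilon> :: "'a::{field,finite}"
  shows "finite ((carrier_vec n :: 'a vec set) \<times> border_corners \<epsilon>)"
    and "(carrier_vec n :: 'a vec set) \<times> border_corners \<epsilon> \<noteq> {}"
proof -
  have "(0\<^sub>v n :: 'a vec, 0) \<in> carrier_vec n \<times> border_corners \<epsilon>" by simp
  then show "(carrier_vec n :: 'a vec set) \<times> border_corners \<epsilon> \<noteq> {}" by blast
qed simp

text \<open>One bordering step is one step of the corank walk. The image of \<open>A\<close> contains a \<open>1 / q\<^sup>k\<close> part of
all columns, \<open>k\<close> being the corank. For a column \<open>A w\<close> in it, the corner \<open>\<epsilon> (A w \<bullet> w)\<close> that raises
the corank is among the admissible ones, since \<open>w \<bullet> A w = \<epsilon> (A w \<bullet> w)\<close>.\<close>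

lemma expectation_random_border:
  fixes A :: "'a::{field,finite} mat" and \<epsilon> :: 'a
  assumes A: "A \<in> carrier_mat n n" and sym: "A\<^sup>T = \<epsilon> \<cdot>\<^sub>m A" and eps: "\<epsilon> * \<epsilon> = 1"
  shows "measure_pmf.expectation (random_border \<epsilon> A) (\<lambda>B. f (corank B))
    = corank_walk (real CARD('a)) (real (card (border_corners \<epsilon>))) f (corank A)"
proof -
  let ?V = "carrier_vec n :: 'a vec set" and ?C = "border_corners \<epsilon>"
  let ?I = "(*\<^sub>v) A ` ?V"
  define q c k where "q = real CARD('a)" and "c = real (card ?C)" and "k = corank A"
  have C: "card ?C \<ge> 1"
    using card_mono[of ?C "{0}"] by simp
  have q: "q > 0" and c: "c > 0" using C by (auto simp: q_def c_def)
  have I: "?I \<subseteq> ?V" using mult_mat_vec_carrier[OF A] by auto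
  have inner: "(\<Sum>x\<in>?C. f (corank (border \<epsilon> A v x)))
      = (if v \<in> ?I then f (k + 1) + (c - 1) * f k else c * f (k - 1))" if v: "v \<in> ?V" for v
  proof (cases "v \<in> ?I")
    case True
    then obtain w where w: "w \<in> ?V" "v = A *\<^sub>v w" by auto
    define a where "a = \<epsilon> * ((A *\<^sub>v w) \<bullet> w)"
    have "a = w \<bullet> (A *\<^sub>v w)"
      using transposed_mult_scalar_prod[OF A sym w(1) w(1)] by (simp add: a_def)
    also have "\<dots> = (A *\<^sub>v w) \<bullet> w"
      using w(1) mult_mat_vec_carrier[OF A w(1)] by (rule comm_scalar_prod)
    finally have corner: "a \<in> ?C" by (simp add: a_def)
    have "(\<Sum>x\<in>?C. f (corank (border \<epsilon> A v x)))
        = (\<Sum>x\<in>?C. f k + (if x = a then f (k + 1) - f k else 0))"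
      unfolding w(2) corank_border_image[OF A sym eps w(1)] a_def[symmetric] k_def[symmetric]
      by (intro sum.cong) auto
    also have "\<dots> = c * f k + (f (k + 1) - f k)"
      using corner by (simp add: sum.distrib c_def)
    also have "\<dots> = f (k + 1) + (c - 1) * f k"
      by (simp add: algebra_simps)
    finally show ?thesis using True by simp
  next
    case False
    have "corank (border \<epsilon> A v x) = k - 1" for x
      using corank_border_not_image[OF A sym eps v False, of x] by (simp add: k_def)
    then show ?thesis using False by (simp add: c_def)
  qed
  have card_I: "real (card ?I) = q ^ n / q ^ k"
  proof -
    have "n = vec_space.rank n A + k" using rank_plus_corank[OF A] by (simp add: k_def)
    then have "q ^ n = q ^ vec_space.rank n A * q ^ k" by (metis power_add)
    then show ?thesis using q card_image_eq_power_rank[OF A] by (simp add: q_def)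
  qed
  have "measure_pmf.expectation (random_border \<epsilon> A) (\<lambda>B. f (corank B))
      = (\<Sum>(v, x)\<in>?V \<times> ?C. f (corank (border \<epsilon> A v x))) / real (card (?V \<times> ?C))"
    using A finite_nonempty_borders[of n \<epsilon>]
    by (simp add: integral_pmf_of_set case_prod_unfold)
  also have "(\<Sum>(v, x)\<in>?V \<times> ?C. f (corank (border \<epsilon> A v x)))
      = (\<Sum>v\<in>?V. if v \<in> ?I then f (k + 1) + (c - 1) * f k else c * f (k - 1))"
    by (subst sum.cartesian_product[symmetric]) (intro sum.cong refl inner)
  also have "\<dots> = real (card ?I) * (f (k + 1) + (c - 1) * f k) + real (card (?V - ?I)) * (c * f (k - 1))"
  proof -
    have "?V \<inter> {v. v \<in> ?I} = ?I" "?V \<inter> - {v. v \<in> ?I} = ?V - ?I" using I by blast+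
    then show ?thesis by (subst sum.If_cases) simp_all
  qed
  also have "real (card (?V - ?I)) = q ^ n - real (card ?I)"
  proof -
    have "card ?I \<le> card ?V" using I by (intro card_mono) simp_all
    then show ?thesis
      using I by (simp add: card_Diff_subset of_nat_diff q_def card_carrier_vec)
  qed
  also have "real (card (?V \<times> ?C)) = q ^ n * c"
    by (simp add: card_cartesian_product card_carrier_vec q_def c_def)
  also have "(real (card ?I) * (f (k + 1) + (c - 1) * f k) + (q ^ n - real (card ?I)) * (c * f (k - 1)))
      / (q ^ n * c) = corank_walk q c f k"
    unfolding card_I corank_walk_def using q c by (simp add: field_simps)
  finally show ?thesis by (simp add: q_def c_def k_def)
qed

lemma bordered_chain_support:
  fixes X :: "nat \<Rightarrow> 'a::{field,finite} mat pmf" and \<epsilon> :: 'a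
  assumes M: "M \<in> carrier_mat m m" and sym: "M\<^sup>T = \<epsilon> \<cdot>\<^sub>m M" and eps: "\<epsilon> * \<epsilon> = 1"
    and X0: "X m = return_pmf M"
    and XSuc: "\<And>n. n \<ge> m \<Longrightarrow> X (Suc n) = bind_pmf (X n) (random_border \<epsilon>)"
  shows "finite (set_pmf (X (m + t))) \<and>
    (\<forall>A\<in>set_pmf (X (m + t)). A \<in> carrier_mat (m + t) (m + t) \<and> A\<^sup>T = \<epsilon> \<cdot>\<^sub>m A)"
proof (induction t)
  case 0
  then show ?case using M sym X0 by simp
next
  case (Suc t)
  have X: "X (m + Suc t) = bind_pmf (X (m + t)) (random_border \<epsilon>)"
    using XSuc[of "m + t"] by simp
  have support: "set_pmf (random_border \<epsilon> A)
      = (\<lambda>(v, c). border \<epsilon> A v c) ` (carrier_vec (dim_row A) \<times> border_corners \<epsilon>)" for A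
    unfolding set_map_pmf set_pmf_of_set[OF finite_nonempty_borders(2,1)] ..
  have fin: "finite (set_pmf (random_border \<epsilon> A))" for A
    unfolding support by (intro finite_imageI finite_nonempty_borders)
  have "B \<in> carrier_mat (m + Suc t) (m + Suc t) \<and> B\<^sup>T = \<epsilon> \<cdot>\<^sub>m B"
    if A: "A \<in> set_pmf (X (m + t))" and B: "B \<in> set_pmf (random_border \<epsilon> A)" for A B
  proof -
    have *: "A \<in> carrier_mat (m + t) (m + t)" "A\<^sup>T = \<epsilon> \<cdot>\<^sub>m A" using A Suc by blast+
    obtain v c where "B = border \<epsilon> A v c" "\<epsilon> * c = c" using B unfolding support by auto
    then show ?thesis
      using border_carrier[OF *(1), of \<epsilon> v c] border_transpose[OF * eps, of c v] by simp
  qed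
  then show ?case
    unfolding X set_bind_pmf using Suc fin by blast
qed

lemma expectation_bordered_chain:
  fixes X :: "nat \<Rightarrow> 'a::{field,finite} mat pmf" and \<epsilon> :: 'a
  assumes M: "M \<in> carrier_mat m m" and sym: "M\<^sup>T = \<epsilon> \<cdot>\<^sub>m M" and eps: "\<epsilon> * \<epsilon> = 1"
    and X0: "X m = return_pmf M"
    and XSuc: "\<And>n. n \<ge> m \<Longrightarrow> X (Suc n) = bind_pmf (X n) (random_border \<epsilon>)"
  shows "measure_pmf.expectation (X (m + t)) (\<lambda>A. f (corank A))
    = (corank_walk (real CARD('a)) (real (card (border_corners \<epsilon>))) ^^ t) f (corank M)"
proof (induction t arbitrary: f)
  case 0
  then show ?case using X0 by simp
next
  case (Suc t)
  let ?W = "corank_walk (real CARD('a)) (real (card (border_corners \<epsilon>)))"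
  let ?S = "set_pmf (X (m + t))"
  have chain: "finite ?S" "\<And>A. A \<in> ?S \<Longrightarrow> A \<in> carrier_mat (m + t) (m + t) \<and> A\<^sup>T = \<epsilon> \<cdot>\<^sub>m A"
    using bordered_chain_support[OF M sym eps X0 XSuc, of t] by auto
  have "measure_pmf.expectation (X (m + Suc t)) (\<lambda>A. f (corank A))
      = (\<Sum>A\<in>?S. pmf (X (m + t)) A *\<^sub>R measure_pmf.expectation (random_border \<epsilon> A) (\<lambda>B. f (corank B)))"
    using XSuc[of "m + t"] chain(1) finite_nonempty_borders[where \<epsilon> = \<epsilon>]
    by (simp add: pmf_expectation_bind)
  also have "\<dots> = (\<Sum>A\<in>?S. pmf (X (m + t)) A *\<^sub>R ?W f (corank A))"
    using chain(2) eps by (intro sum.cong refl arg_cong2[where f = scaleR] expectation_random_border) auto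
  also have "\<dots> = measure_pmf.expectation (X (m + t)) (\<lambda>A. ?W f (corank A))"
    using chain(1) by (simp add: integral_measure_pmf)
  also have "\<dots> = (?W ^^ t) (?W f) (corank M)" by (rule Suc.IH)
  finally show ?case by (simp add: funpow_swap1)
qed

text \<open>The probability of a set \<open>A\<close> after \<open>t\<close> steps is the value at the corank of \<open>M\<close> of the \<open>t\<close>-th
iterate of its indicator, and the probability under \<open>\<pi> (m + t)\<close> is the average of this iterate
over \<open>\<pi> m\<close>. The steps of the iterate are at most \<open>q ^ k / q ^ t\<close>.\<close>

lemma tv_dist_bordered_chain:
  fixes X :: "nat \<Rightarrow> 'a::{field,finite} mat pmf" and M :: "'a mat" and \<epsilon> :: 'a
  defines "q \<equiv> real CARD('a)" and "c \<equiv> real (card (border_corners \<epsilon>))"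
  assumes M: "M \<in> carrier_mat m m" and sym: "M\<^sup>T = \<epsilon> \<cdot>\<^sub>m M" and eps: "\<epsilon> * \<epsilon> = 1"
    and X0: "X m = return_pmf M"
    and XSuc: "\<And>n. n \<ge> m \<Longrightarrow> X (Suc n) = bind_pmf (X n) (random_border \<epsilon>)"
    and w: "walk_type q c d"
    and bal: "\<And>n. corank_balanced q c (\<pi> n) (\<pi> (Suc n))" "\<And>n. corank_balanced q c (\<pi> (Suc n)) (\<pi> n)"
    and lazy: "\<And>n. c = 1 \<or> \<pi> (Suc n) = \<pi> n"
    and cong: "\<And>k. pmf (\<pi> m) k \<noteq> 0 \<Longrightarrow> corank M mod d = k mod d"
  shows "tv_dist (map_pmf corank (X (m + t))) (\<pi> (m + t)) \<le> q ^ m / q ^ t"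
  unfolding tv_dist_def
proof (rule cSUP_least)
  fix A :: "nat set"
  define f where "f = (indicator A :: nat \<Rightarrow> real)"
  have f1: "\<bar>f k\<bar> \<le> 1" for k by (simp add: f_def indicator_def)
  have q: "q \<ge> 2" using w by (simp add: walk_type_def)
  let ?F = "(corank_walk q c ^^ t) f"
  have "measure_pmf.prob (map_pmf corank (X (m + t))) A = measure_pmf.expectation (X (m + t)) (\<lambda>B. f (corank B))"
    using integral_map_pmf[of corank "X (m + t)" f] by (simp add: f_def)
  also have "\<dots> = ?F (corank M)"
    unfolding q_def c_def by (rule expectation_bordered_chain[OF M sym eps X0 XSuc])
  finally have 1: "measure_pmf.prob (map_pmf corank (X (m + t))) A = ?F (corank M)" .
  have 2: "measure_pmf.prob (\<pi> (m + t)) A = measure_pmf.expectation (\<pi> m) ?F"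
    using corank_walk_iterate_stationary[where \<pi> = \<pi>, OF w bal lazy f1, of m t] by (simp add: f_def)
  have step: "\<bar>f (k + d) - f k\<bar> \<le> 1 * q ^ k" for k
  proof -
    have "\<bar>f (k + d) - f k\<bar> \<le> 1" by (simp add: f_def indicator_def)
    also have "1 \<le> q ^ k" using q by simp
    finally show ?thesis by simp
  qed
  have "\<bar>?F (corank M) - measure_pmf.expectation (\<pi> m) ?F\<bar> \<le> 1 / q ^ t * q ^ corank M"
    using q by (intro expectation_diff_le[OF w bal(2) cong
          corank_walk_iterate_contraction[OF w step] _ corank_walk_iterate_bounded[OF w f1]]) auto
  also have "\<dots> \<le> 1 / q ^ t * q ^ m"
    using q corank_le[OF M] by (intro mult_left_mono power_increasing) auto
  finally show "\<bar>measure_pmf.prob (map_pmf corank (X (m + t))) A - measure_pmf.prob (\<pi> (m + t)) A\<bar>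
      \<le> q ^ m / q ^ t"
    using 1 2 by simp
qed simp

section \<open>The symmetric and the alternating extension\<close>

lemma uniform_last_column_with_corner:
  "map_pmf (\<lambda>u. (Matrix.vec n (\<lambda>i. u (i, n)), u (n, n)))
     (Pi_pmf {(i, j). i \<le> j \<and> j = n} 0 (\<lambda>_. pmf_of_set (UNIV :: 'a::{field,finite} set)))
   = pmf_of_set (carrier_vec n \<times> UNIV)" (is "map_pmf ?h (Pi_pmf ?T _ _) = _")
proof -
  have "?T = (\<lambda>i. (i, n)) ` {..n}" by auto
  then have T: "finite ?T" by simp
  let ?g = "\<lambda>(v, c) (i, j). if j = n \<and> i < n then v $ i else if j = n \<and> i = n then c else 0"
  have "bij_betw ?h (PiE_dflt ?T 0 (\<lambda>_. UNIV)) (carrier_vec n \<times> UNIV)"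
    by (rule bij_betwI[where g = ?g]) (auto simp: PiE_dflt_def fun_eq_iff)
  then have "map_pmf ?h (pmf_of_set (PiE_dflt ?T 0 (\<lambda>_. UNIV))) = pmf_of_set (carrier_vec n \<times> UNIV)"
    using T by (intro map_pmf_of_set_bij_betw) auto
  then show ?thesis using T by (simp add: Pi_pmf_of_set)
qed

lemma uniform_last_column_zero_corner:
  "map_pmf (\<lambda>u. (Matrix.vec n (\<lambda>i. u (i, n)), 0))
     (Pi_pmf {(i, j). i < j \<and> j = n} 0 (\<lambda>_. pmf_of_set (UNIV :: 'a::{field,finite} set)))
   = pmf_of_set (carrier_vec n \<times> {0})" (is "map_pmf ?h (Pi_pmf ?T _ _) = _")
proof -
  have "?T = (\<lambda>i. (i, n)) ` {..<n}" by auto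
  then have T: "finite ?T" by simp
  let ?g = "\<lambda>(v, c) (i, j). if j = n \<and> i < n then v $ i else 0"
  have "bij_betw ?h (PiE_dflt ?T 0 (\<lambda>_. UNIV)) (carrier_vec n \<times> {0})"
    by (rule bij_betwI[where g = ?g]) (auto simp: PiE_dflt_def fun_eq_iff)
  then have "map_pmf ?h (pmf_of_set (PiE_dflt ?T 0 (\<lambda>_. UNIV))) = pmf_of_set (carrier_vec n \<times> {0})"
    using T by (intro map_pmf_of_set_bij_betw) auto
  then show ?thesis using T by (simp add: Pi_pmf_of_set)
qed

lemma two_neq_zero_of_odd_card:
  assumes "odd CARD('a::{field,finite})"
  shows "(2 :: 'a) \<noteq> 0"
proof
  assume two: "(2 :: 'a) = 0"
  have "of_nat CARD('a) = (0 :: 'a)"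
    using CHAR_dvd_CARD[where 'a = 'a] by (simp add: of_nat_eq_0_iff_char_dvd)
  moreover obtain k where "CARD('a) = 2 * k + 1" using assms by (auto elim: oddE)
  ultimately have "(2 :: 'a) * of_nat k + 1 = 0" by (metis of_nat_add of_nat_mult of_nat_numeral of_nat_1)
  then show False using two by simp
qed

lemma border_corners_minus_one:
  assumes "odd CARD('a::{field,finite})"
  shows "border_corners (- 1 :: 'a) = {0}"
proof -
  have zero: "c = 0" if "- 1 * c = c" for c :: 'a
  proof -
    have "2 * c = c - (- 1 * c)" by simp
    also have "\<dots> = 0" unfolding that by simp
    finally show ?thesis using two_neq_zero_of_odd_card[OF assms] by simp
  qed
  show ?thesis
  proof (intro equalityI subsetI)
    fix c :: 'a assume "c \<in> border_corners (- 1)"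
    then have "- 1 * c = c" by (rule CollectD)
    then show "c \<in> {0}" by (simp only: zero singleton_iff)
  qed simp
qed

lemma random_symmetric_extension_self:
  assumes "M \<in> carrier_mat m m"
  shows "random_symmetric_extension m m M = return_pmf M"
proof -
  have no_entries: "{(i, j). i \<le> j \<and> j < m \<and> \<not> (i < m \<and> j < m)} = {}" by auto
  show ?thesis
    using assms unfolding random_symmetric_extension_def no_entries by (auto intro!: eq_matI)
qed

lemma random_alternating_extension_self:
  assumes "M \<in> carrier_mat m m"
  shows "random_alternating_extension m m M = return_pmf M"
proof -
  have no_entries: "{(i, j). i < j \<and> j < m \<and> \<not> (i < m \<and> j < m)} = {}" by auto
  show ?thesis
    using assms unfolding random_alternating_extension_def no_entries by (auto intro!: eq_matI)
qed

text \<open>The free entries with column index below \<open>n\<close> fill the \<open>n \<times> n\<close> extension, and those in column \<open>n\<close>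
are independent of them and form the border.\<close>

lemma random_symmetric_extension_Suc:
  fixes M :: "'a::{field,finite} mat"
  assumes "m \<le> n"
  shows "random_symmetric_extension (Suc n) m M
    = bind_pmf (random_symmetric_extension n m M) (random_border 1)"
proof -
  define S T :: "(nat \<times> nat) set" where "S = {(i, j). i \<le> j \<and> j < n \<and> \<not> (i < m \<and> j < m)}"
    and "T = {(i, j). i \<le> j \<and> j = n}"
  define G where "G = (\<lambda>k (u :: nat \<times> nat \<Rightarrow> 'a). Matrix.mat k k (\<lambda>(i, j).
    if i < m \<and> j < m then M $$ (i, j) else if i \<le> j then u (i, j) else u (j, i)))"
  define h where "h = (\<lambda>u :: nat \<times> nat \<Rightarrow> 'a. (Matrix.vec n (\<lambda>i. u (i, n)), u (n, n)))"
  let ?P = "\<lambda>I. Pi_pmf I 0 (\<lambda>_. pmf_of_set (UNIV :: 'a set))"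
  have "S \<subseteq> {..n} \<times> {..n}" "T \<subseteq> {..n} \<times> {..n}" by (auto simp: S_def T_def)
  then have fin: "finite S" "finite T" using finite_subset by fastforce+
  have split: "{(i, j). i \<le> j \<and> j < Suc n \<and> \<not> (i < m \<and> j < m)} = S \<union> T" "S \<inter> T = {}"
    using assms by (auto simp: S_def T_def)
  have "G (Suc n) (\<lambda>x. if x \<in> S then f x else g x) = (case h g of (v, c) \<Rightarrow> border 1 (G n f) v c)" for f g
    using assms by (auto simp: G_def h_def border_def S_def less_Suc_eq intro!: eq_matI)
  moreover have ext: "random_symmetric_extension k m M
      = map_pmf (G k) (?P {(i, j). i \<le> j \<and> j < k \<and> \<not> (i < m \<and> j < m)})" for k
    by (simp only: random_symmetric_extension_def G_def)
  ultimately have "random_symmetric_extension (Suc n) m M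
      = bind_pmf (map_pmf (G n) (?P S)) (\<lambda>A. map_pmf (\<lambda>(v, c). border 1 A v c) (map_pmf h (?P T)))"
    unfolding ext split(1)
    by (subst Pi_pmf_union[OF fin split(2)])
      (simp add: pair_pmf_def map_bind_pmf bind_map_pmf map_pmf_def bind_assoc_pmf bind_return_pmf)
  also have "map_pmf h (?P T) = pmf_of_set (carrier_vec n \<times> UNIV)"
    unfolding h_def T_def by (rule uniform_last_column_with_corner)
  also have "bind_pmf (map_pmf (G n) (?P S))
        (\<lambda>A. map_pmf (\<lambda>(v, c). border 1 A v c) (pmf_of_set (carrier_vec n \<times> UNIV)))
      = bind_pmf (map_pmf (G n) (?P S)) (random_border 1)"
    unfolding bind_map_pmf by (simp add: G_def)
  finally show ?thesis
    by (simp only: ext S_def)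
qed

lemma random_alternating_extension_Suc:
  fixes M :: "'a::{field,finite} mat"
  assumes "m \<le> n" and odd: "odd CARD('a)"
  shows "random_alternating_extension (Suc n) m M
    = bind_pmf (random_alternating_extension n m M) (random_border (- 1))"
proof -
  define S T :: "(nat \<times> nat) set" where "S = {(i, j). i < j \<and> j < n \<and> \<not> (i < m \<and> j < m)}"
    and "T = {(i, j). i < j \<and> j = n}"
  define G where "G = (\<lambda>k (u :: nat \<times> nat \<Rightarrow> 'a). Matrix.mat k k (\<lambda>(i, j).
    if i < m \<and> j < m then M $$ (i, j) else if i < j then u (i, j) else if i = j then 0 else - u (j, i)))"
  define h where "h = (\<lambda>u :: nat \<times> nat \<Rightarrow> 'a. (Matrix.vec n (\<lambda>i. u (i, n)), 0 :: 'a))"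
  let ?P = "\<lambda>I. Pi_pmf I 0 (\<lambda>_. pmf_of_set (UNIV :: 'a set))"
  have "S \<subseteq> {..n} \<times> {..n}" "T \<subseteq> {..n} \<times> {..n}" by (auto simp: S_def T_def)
  then have fin: "finite S" "finite T" using finite_subset by fastforce+
  have split: "{(i, j). i < j \<and> j < Suc n \<and> \<not> (i < m \<and> j < m)} = S \<union> T" "S \<inter> T = {}"
    using assms by (auto simp: S_def T_def)
  have "G (Suc n) (\<lambda>x. if x \<in> S then f x else g x) = (case h g of (v, c) \<Rightarrow> border (- 1) (G n f) v c)" for f g
    using assms by (auto simp: G_def h_def border_def S_def less_Suc_eq intro!: eq_matI)
  moreover have ext: "random_alternating_extension k m M
      = map_pmf (G k) (?P {(i, j). i < j \<and> j < k \<and> \<not> (i < m \<and> j < m)})" for k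
    by (simp only: random_alternating_extension_def G_def)
  ultimately have "random_alternating_extension (Suc n) m M
      = bind_pmf (map_pmf (G n) (?P S)) (\<lambda>A. map_pmf (\<lambda>(v, c). border (- 1) A v c) (map_pmf h (?P T)))"
    unfolding ext split(1)
    by (subst Pi_pmf_union[OF fin split(2)])
      (simp add: pair_pmf_def map_bind_pmf bind_map_pmf map_pmf_def bind_assoc_pmf bind_return_pmf)
  also have "map_pmf h (?P T) = pmf_of_set (carrier_vec n \<times> border_corners (- 1))"
    unfolding h_def T_def border_corners_minus_one[OF odd] by (rule uniform_last_column_zero_corner)
  also have "bind_pmf (map_pmf (G n) (?P S))
        (\<lambda>A. map_pmf (\<lambda>(v, c). border (- 1) A v c) (pmf_of_set (carrier_vec n \<times> border_corners (- 1))))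
      = bind_pmf (map_pmf (G n) (?P S)) (random_border (- 1))"
    unfolding bind_map_pmf by (simp add: G_def)
  finally show ?thesis
    by (simp only: ext S_def)
qed

text \<open>A matrix is obtained from its upper left corner by bordering, and with corner \<open>0\<close> a bordering always
changes the corank by exactly one: here \<open>A w \<bullet> w = 0\<close>, as this number is its own negative and \<open>q\<close> is
odd.\<close>

lemma corank_alternating_parity:
  fixes A :: "'a::{field,finite} mat"
  assumes odd: "odd CARD('a)" and A: "A \<in> carrier_mat n n" "A\<^sup>T = (- 1) \<cdot>\<^sub>m A"
  shows "corank A mod 2 = n mod 2"
  using A
proof (induction n arbitrary: A)
  case 0
  then show ?case using corank_le[of A 0] by simp
next
  case (Suc n)
  define B v where "B = Matrix.mat n n (\<lambda>(i, j). A $$ (i, j))" and "v = Matrix.vec n (\<lambda>i. A $$ (i, n))"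
  have entry: "A $$ (j, i) = - A $$ (i, j)" if "i < Suc n" "j < Suc n" for i j
  proof -
    have "A\<^sup>T $$ (i, j) = ((- 1) \<cdot>\<^sub>m A) $$ (i, j)" by (simp only: Suc.prems)
    then show ?thesis using that Suc.prems(1) by simp
  qed
  have zero: "x = 0" if "- 1 * x = x" for x :: 'a
    using border_corners_minus_one[OF odd] that by blast
  have diag: "A $$ (n, n) = 0"
    by (rule zero) (metis entry lessI mult_minus1)
  have B: "B \<in> carrier_mat n n" by (simp add: B_def)
  have BT: "B\<^sup>T = (- 1) \<cdot>\<^sub>m B"
  proof (rule eq_matI)
    fix i j assume "i < dim_row ((- 1) \<cdot>\<^sub>m B)" "j < dim_col ((- 1) \<cdot>\<^sub>m B)"
    then have ij: "i < n" "j < n" using B by simp_all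
    then have "A $$ (j, i) = - A $$ (i, j)" by (intro entry) simp_all
    then show "B\<^sup>T $$ (i, j) = ((- 1) \<cdot>\<^sub>m B) $$ (i, j)" using ij by (simp add: B_def)
  qed (simp_all add: B_def)
  have last_row: "A $$ (n, j) = - A $$ (j, n)" if "j < n" for j
    using that by (intro entry) simp_all
  have v: "v \<in> carrier_vec n" by (simp add: v_def)
  have AB: "A = border (- 1) B v 0"
    using Suc.prems(1) diag last_row by (auto simp: border_def B_def v_def less_Suc_eq intro!: eq_matI)
  have IH: "corank B mod 2 = n mod 2" by (rule Suc.IH[OF B BT])
  show ?case
  proof (cases "v \<in> (*\<^sub>v) B ` carrier_vec n")
    case True
    then obtain w where w: "w \<in> carrier_vec n" "v = B *\<^sub>v w" by auto
    have "(B *\<^sub>v w) \<bullet> w = 0"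
    proof (rule zero)
      have "- 1 * ((B *\<^sub>v w) \<bullet> w) = w \<bullet> (B *\<^sub>v w)"
        using transposed_mult_scalar_prod[OF B BT w(1) w(1)] by simp
      also have "\<dots> = (B *\<^sub>v w) \<bullet> w"
        using w(1) mult_mat_vec_carrier[OF B w(1)] by (rule comm_scalar_prod)
      finally show "- 1 * ((B *\<^sub>v w) \<bullet> w) = (B *\<^sub>v w) \<bullet> w" .
    qed
    then have "corank A = corank B + 1"
      using corank_border_image[OF B BT _ w(1), of 0] by (simp add: AB w(2))
    then show ?thesis using IH by (metis Suc_eq_plus1 mod_Suc_eq)
  next
    case False
    have "corank B = Suc (corank A)"
      using corank_border_not_image[OF B BT _ v False, of 0] by (simp add: AB)
    then show ?thesis using IH by presburger
  qed
qed

lemma mass_ratio: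
  assumes "q \<ge> 2"
  shows "a / (\<Prod>i=1..k + 1. real q ^ i - 1) * (real q ^ (k + 1) - 1) = a / (\<Prod>i=1..k. real q ^ i - 1)"
proof -
  have "1 < real q ^ (k + 1)"
    using assms by (intro one_less_power) auto
  then have "real q ^ (k + 1) - 1 \<noteq> 0" by linarith
  moreover have "(\<Prod>i=1..k + 1. real q ^ i - 1) = (\<Prod>i=1..k. real q ^ i - 1) * (real q ^ (k + 1) - 1)"
    by (simp del: power_Suc)
  moreover have "a / (P * r) * r = a / P" if "r \<noteq> 0" for P r :: real
    using that by simp
  ultimately show ?thesis by (simp only: not_False_eq_True)
qed

lemma Q_sym_infty_balanced:
  assumes "q \<ge> 2"
  shows "corank_balanced (real q) (real q) (Q_sym_infty q) (Q_sym_infty q)"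
  unfolding corank_balanced_def pmf_Q_sym_infty[OF assms] sym_mass_def mass_ratio[OF assms]
  using assms by simp

lemma alt_mass_ratio:
  assumes "q \<ge> 2"
  shows "L * (real q ^ (k + 1) / (\<Prod>i=1..k + 1. real q ^ i - 1)) * (real q ^ (k + 1) - 1)
    = real q / 1 * (L * (real q ^ k / (\<Prod>i=1..k. real q ^ i - 1)))"
  unfolding mult.assoc mass_ratio[OF assms] by simp

lemma Q_alt_balanced:
  assumes "q \<ge> 2"
  shows "corank_balanced (real q) 1 (Q_alt_e q) (Q_alt_o q)"
    and "corank_balanced (real q) 1 (Q_alt_o q) (Q_alt_e q)"
proof -
  show "corank_balanced (real q) 1 (Q_alt_e q) (Q_alt_o q)"
    unfolding corank_balanced_def pmf_Q_alt_e[OF assms] pmf_Q_alt_o[OF assms]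
      alt_even_mass_def alt_odd_mass_def
    by (simp only: alt_mass_ratio[OF assms] even_plus_one_iff mult_zero_left mult_zero_right
        not_not if_distrib split: if_split) simp
  show "corank_balanced (real q) 1 (Q_alt_o q) (Q_alt_e q)"
    unfolding corank_balanced_def pmf_Q_alt_e[OF assms] pmf_Q_alt_o[OF assms]
      alt_even_mass_def alt_odd_mass_def
    by (simp only: alt_mass_ratio[OF assms] even_plus_one_iff mult_zero_left mult_zero_right
        not_not if_distrib split: if_split) simp
qed

lemma tv_dist_le_1: "tv_dist p p' \<le> 1"
  unfolding tv_dist_def
proof (rule cSUP_least)
  fix A
  show "\<bar>measure_pmf.prob p A - measure_pmf.prob p' A\<bar> \<le> 1"
    using measure_pmf.prob_le_1[of p A] measure_pmf.prob_le_1[of p' A]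
      measure_nonneg[of p A] measure_nonneg[of p' A] by linarith
qed simp

text \<open>For \<open>t < m\<close> the right-hand side is at least \<open>1\<close>; for \<open>t \<ge> m\<close>, halving the exponent of
\<open>q powr (m - t)\<close> can only increase the value.\<close>

lemma contraction_bound_le:
  fixes x q :: real and m t :: nat
  assumes q: "q \<ge> 1" and x: "x \<le> 1" "x \<le> q ^ m / q ^ t"
  shows "x \<le> 3 powr (real (m + t) / 2) / q powr (real (m + t) / 2 - real m)"
proof -
  let ?e = "(real m - real t) / 2"
  have "x \<le> q powr ?e"
  proof (cases "m \<le> t")
    case True
    have "x \<le> q powr (real m - real t)"
      using x q by (simp add: powr_diff powr_realpow)
    also have "\<dots> \<le> q powr ?e"
      using True q by (intro powr_mono) auto
    finally show ?thesis .
  next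
    case False
    then have "1 \<le> q powr ?e" using q by (intro ge_one_powr_ge_zero) auto
    then show ?thesis using x by linarith
  qed
  also have "\<dots> \<le> 3 powr (real (m + t) / 2) * q powr ?e"
    using mult_right_mono[OF ge_one_powr_ge_zero[of 3 "real (m + t) / 2"], of "q powr ?e"] by simp
  also have "q powr ?e = 1 / q powr (real (m + t) / 2 - real m)"
  proof -
    have "?e = - (real (m + t) / 2 - real m)" by (simp add: field_simps)
    then show ?thesis by (simp only: powr_minus_divide)
  qed
  finally show ?thesis by simp
qed

theorem theorem1p14:
  fixes M :: "'a::{field,finite} mat" and q n m\<^sub>0 :: nat
  assumes "q = CARD('a)"
    and "n \<ge> 1" and "m\<^sub>0 \<le> n"
    and "M \<in> carrier_mat m\<^sub>0 m\<^sub>0"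
  shows "(symmetric M \<longrightarrow>
            tv_dist (map_pmf corank (random_symmetric_extension n m\<^sub>0 M)) (Q_sym_infty q)
              \<le> 3 powr (real n / 2) / real q powr (real n / 2 - real m\<^sub>0)) \<and>
         (alternating M \<and> odd q \<longrightarrow>
            tv_dist (map_pmf corank (random_alternating_extension n m\<^sub>0 M))
                (if even n then Q_alt_e q else Q_alt_o q)
              \<le> 3 powr (real n / 2) / real q powr (real n / 2 - real m\<^sub>0))"
proof -
  have q: "q \<ge> 2" using card_field_ge_2[where 'a = 'a] assms(1) by simp
  obtain t where t: "n = m\<^sub>0 + t" using assms(3) by (auto simp: le_iff_add)
  note M = assms(4)
  have sym: "tv_dist (map_pmf corank (random_symmetric_extension n m\<^sub>0 M)) (Q_sym_infty q)
      \<le> 3 powr (real n / 2) / real q powr (real n / 2 - real m\<^sub>0)" if "symmetric M"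
  proof -
    have MT: "M\<^sup>T = 1 \<cdot>\<^sub>m M" using that M by (auto simp: symmetric_def)
    have c: "card (border_corners (1 :: 'a)) = q" using assms(1) by simp
    have "tv_dist (map_pmf corank (random_symmetric_extension (m\<^sub>0 + t) m\<^sub>0 M)) (Q_sym_infty q)
        \<le> real CARD('a) ^ m\<^sub>0 / real CARD('a) ^ t"
      by (rule tv_dist_bordered_chain[where d = 1 and \<epsilon> = 1 and \<pi> = "\<lambda>_. Q_sym_infty q", OF M MT])
        (use q M Q_sym_infty_balanced[OF q] in
          \<open>auto simp: assms(1)[symmetric] c walk_type_def random_symmetric_extension_self
             random_symmetric_extension_Suc\<close>)
    then show ?thesis
      unfolding t using q tv_dist_le_1 by (intro contraction_bound_le) (auto simp: assms(1))
  qed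
  have alt: "tv_dist (map_pmf corank (random_alternating_extension n m\<^sub>0 M))
        (if even n then Q_alt_e q else Q_alt_o q)
      \<le> 3 powr (real n / 2) / real q powr (real n / 2 - real m\<^sub>0)" if "alternating M" "odd q"
  proof -
    have MT: "M\<^sup>T = (- 1) \<cdot>\<^sub>m M"
      using that M by (auto simp: alternating_def intro!: eq_matI)
    have odd: "odd CARD('a)" using that assms(1) by simp
    have c: "card (border_corners (- 1 :: 'a)) = 1" by (simp only: border_corners_minus_one[OF odd]) simp
    let ?\<pi> = "\<lambda>n. if even n then Q_alt_e q else Q_alt_o q"
    \<comment> \<open>The limit law for size \<open>m\<^sub>0\<close> lives on the coranks of the parity of \<open>m\<^sub>0\<close>, like \<open>M\<close>.\<close>
    have par: "corank M mod 2 = k mod 2" if "pmf (?\<pi> m\<^sub>0) k \<noteq> 0" for k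
    proof -
      have "k mod 2 = m\<^sub>0 mod 2"
        using that q by (auto simp: pmf_Q_alt_e pmf_Q_alt_o alt_even_mass_def alt_odd_mass_def
            even_iff_mod_2_eq_zero odd_iff_mod_2_eq_one split: if_splits)
      then show ?thesis using corank_alternating_parity[OF odd M MT] by simp
    qed
    have "tv_dist (map_pmf corank (random_alternating_extension (m\<^sub>0 + t) m\<^sub>0 M)) (?\<pi> (m\<^sub>0 + t))
        \<le> real CARD('a) ^ m\<^sub>0 / real CARD('a) ^ t"
      by (rule tv_dist_bordered_chain[where d = 2 and \<epsilon> = "- 1" and \<pi> = ?\<pi>, OF M MT])
        (use q M Q_alt_balanced[OF q] par c in
          \<open>auto simp: assms(1)[symmetric] walk_type_def random_alternating_extension_self
             random_alternating_extension_Suc[OF _ odd]\<close>)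
    then show ?thesis
      unfolding t using q tv_dist_le_1 by (intro contraction_bound_le) (auto simp: assms(1))
  qed
  show ?thesis using sym alt by blast
qed

end
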